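(* Let $M,M'\subseteq\mathbb{C}^{n+1}$ be real analytic hypersurfaces through $0$, given near $0$ in normal coordinates by $w=Q(z,\bar z,\bar w)$ and $w'=Q'(z',\bar z',\bar w')$ respectively, with complexifications $\mathcal{M}$ and $\mathcal{M}'$. Assume that $M$ is holomorphically nondegenerate, and let $\mathcal{H}=(f,g,\tilde f,\tilde g)$ be a holomorphic Segre preserving map (HSPM) sending $(\mathcal{M},0)$ into $(\mathcal{M}',0)$. Then one of the following two possibilities must hold: (1) $\mathcal{H}$ is transversally null, and $Q'\big(f(z,w),\tilde f(\chi,\tau),0\big)\equiv 0$; that is, $\mathcal{H}$ maps a neighborhood of $0$ in $\mathbb{C}^{2n+2}$ into $\mathcal{M}'$. (2) $\mathcal{H}$ is a biholomorphism near some $p\in\mathcal{M}$ (in the domain of definition of $\mathcal{H}$). Furthermore, $M'$ is holomorphically nondegenerate.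
   Context: Here $n\ge 1$, and everything is local near $0$. Coordinates on $\mathbb{C}^{n+1}\times\mathbb{C}^{n+1}$ are $(Z,\zeta)$ with $Z=(z,w)\in\mathbb{C}^n\times\mathbb{C}$, $\zeta=(\chi,\tau)\in\mathbb{C}^n\times\mathbb{C}$ (primed for the target). Normal coordinates: the real analytic hypersurface $M\subseteq\mathbb{C}^{n+1}$ is given near $0\in M$ by $w=Q(z,\bar z,\bar w)$, where $Q(z,\chi,\tau)$ is holomorphic near $0$ in $\mathbb{C}^n\times\mathbb{C}^n\times\mathbb{C}$ and $Q(0,\chi,\tau)\equiv Q(z,0,\tau)\equiv\tau$. Since $M$ is a real hypersurface, $Q(z,\chi,\overline{Q}(\chi,z,w))\equiv w$, where $\overline{\varphi}(x):=\overline{\varphi(\bar x)}$. Similarly for $M'$ and $Q'$. Complexification: $\mathcal{M}$ is the holomorphic hypersurface $\{(z,w,\chi,\tau): w=Q(z,\chi,\tau)\}$ in $\mathbb{C}^{2n+2}$ near $0$; similarly $\mathcal{M}'$ with $Q'$. HSPM: a holomorphic Segre preserving map sending $(\mathcal{M},0)$ into $(\mathcal{M}',0)$ is a holomorphic map, defined near $0$ in $\mathbb{C}^{2n+2}$, of the form $\mathcal{H}(z,w,\chi,\tau)=\big(H(z,w),\widetilde H(\chi,\tau)\big)=\big(f(z,w),g(z,w),\tilde f(\chi,\tau),\tilde g(\chi,\tau)\big)$ with $\mathcal{H}(0)=0$ and $\mathcal{H}$ mapping $\mathcal{M}$ (near $0$) into $\mathcal{M}'$; here $f,\tilde f$ are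 $\mathbb{C}^n$-valued and $g,\tilde g$ are $\mathbb{C}$-valued holomorphic functions. ($\widetilde H$ need not be related to $\overline H$.) Transversally null: $g(z,w)\equiv 0$ and $\tilde g(\chi,\tau)\equiv 0$. Generic rank of a holomorphic map $\varphi(Z)$: the largest integer $r$ such that some $r\times r$ minor of the Jacobian matrix $\partial\varphi/\partial Z$ is not identically $0$. Holomorphically nondegenerate (at $0$): there is an integer $K$ such that the map $(\chi,\tau)\mapsto\big(Q_{z^\alpha}(0,\chi,\tau)\big)_{|\alpha|\le K}$ has generic rank $n+1$. Equivalently, there is no germ at $0$ of a nontrivial vector field $\sum_j a_j(Z)\,\partial/\partial Z_j$ with holomorphic coefficients which is tangent to $M$. For connected $M$ this property at one point is equivalent to the property at every point. The same definition applies to $M'$ with $Q'$. *)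

theory Defs
  imports "HOL-Analysis.Analysis"
begin

section \<open>Complex normed spaces and holomorphic maps\<close>

class complex_normed_vector = real_normed_vector +
  fixes scaleC :: "complex \<Rightarrow> 'a \<Rightarrow> 'a"  (infixr \<open>*\<^sub>C\<close> 75)
  assumes scaleC_add_right: "a *\<^sub>C (x + y) = a *\<^sub>C x + a *\<^sub>C y"
    and scaleC_add_left: "(a + b) *\<^sub>C x = a *\<^sub>C x + b *\<^sub>C x"
    and scaleC_scaleC: "a *\<^sub>C (b *\<^sub>C x) = (a * b) *\<^sub>C x"
    and scaleC_of_real: "complex_of_real r *\<^sub>C x = r *\<^sub>R x"
    and norm_scaleC: "norm (a *\<^sub>C x) = cmod a * norm x"

instantiation complex :: complex_normed_vector
begin
definition scaleC_complex_def: "a *\<^sub>C (x::complex) = a * x"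
instance
  by standard (simp_all add: scaleC_complex_def distrib_left distrib_right norm_mult
      scaleR_conv_of_real)
end

instantiation prod :: (complex_normed_vector, complex_normed_vector) complex_normed_vector
begin
definition scaleC_prod_def: "a *\<^sub>C x = (a *\<^sub>C fst x, a *\<^sub>C snd x)"
instance
proof
  fix a :: complex and x :: "'a \<times> 'b"
  have "sqrt ((cmod a * norm (fst x))\<^sup>2 + (cmod a * norm (snd x))\<^sup>2)
      = cmod a * sqrt ((norm (fst x))\<^sup>2 + (norm (snd x))\<^sup>2)"
    by (metis (no_types, lifting) power_mult_distrib distrib_left real_sqrt_mult real_sqrt_abs abs_norm_cancel)
  then show "norm (a *\<^sub>C x) = cmod a * norm x"
    by (simp add: scaleC_prod_def norm_prod_def norm_scaleC)
qed (simp_all add: scaleC_prod_def scaleC_add_right scaleC_add_left scaleC_scaleC scaleC_of_real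
    prod_eq_iff)
end

instantiation vec :: (complex_normed_vector, finite) complex_normed_vector
begin
definition scaleC_vec_def: "a *\<^sub>C x = (\<chi> i. a *\<^sub>C (x $ i))"
instance
proof
  fix a :: complex and x :: "'a ^ 'b"
  show "norm (a *\<^sub>C x) = cmod a * norm x"
    by (simp add: scaleC_vec_def norm_vec_def norm_scaleC L2_set_right_distrib)
qed (simp_all add: scaleC_vec_def vec_eq_iff scaleC_add_right scaleC_add_left scaleC_scaleC
    scaleC_of_real)
end

text \<open>Complex Frechet differentiability; used for open sets only.\<close>

definition holomorphic_map_on ::
    "('a::complex_normed_vector \<Rightarrow> 'b::complex_normed_vector) \<Rightarrow> 'a set \<Rightarrow> bool"
    (infixl \<open>holomorphic'_map'_on\<close> 50) where
  "F holomorphic_map_on S \<longleftrightarrow>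
     (\<forall>x\<in>S. \<exists>D. (F has_derivative D) (at x) \<and> (\<forall>c v. D (c *\<^sub>C v) = c *\<^sub>C D v))"

lemma holomorphic_map_on_complex:
  fixes F :: "complex \<Rightarrow> complex"
  assumes "open S"
  shows "F holomorphic_map_on S \<longleftrightarrow> F holomorphic_on S"
proof -
  have eq: "(\<exists>D. (F has_derivative D) (at x) \<and> (\<forall>c v. D (c *\<^sub>C v) = c *\<^sub>C D v))
      \<longleftrightarrow> F field_differentiable at x" for x
  proof
    assume "\<exists>D. (F has_derivative D) (at x) \<and> (\<forall>c v. D (c *\<^sub>C v) = c *\<^sub>C D v)"
    then obtain D where D: "(F has_derivative D) (at x)" and lin: "\<forall>c v. D (c *\<^sub>C v) = c *\<^sub>C D v"
      by blast
    have "D = (*) (D 1)"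
    proof
      fix c
      show "D c = D 1 * c"
        using lin[rule_format, of c 1] unfolding scaleC_complex_def mult_1_right
        by (simp only: mult.commute)
    qed
    then have "(F has_field_derivative D 1) (at x)"
      using D unfolding has_field_derivative_def by metis
    then show "F field_differentiable at x"
      unfolding field_differentiable_def by (rule exI)
  next
    assume "F field_differentiable at x"
    then obtain d where "(F has_derivative (*) d) (at x)"
      unfolding field_differentiable_def has_field_derivative_def by blast
    moreover have "\<forall>c v. d * (c *\<^sub>C v) = c *\<^sub>C (d * v)"
      by (simp add: scaleC_complex_def mult.left_commute)
    ultimately show "\<exists>D. (F has_derivative D) (at x) \<and> (\<forall>c v. D (c *\<^sub>C v) = c *\<^sub>C D v)"
      by (intro exI conjI)
  qed
  have "at x within S = at x" if "x \<in> S" for x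
    using that assms by (rule at_within_open)
  then show ?thesis
    unfolding holomorphic_map_on_def holomorphic_on_def eq by simp
qed

definition biholomorphic_near ::
    "('a::complex_normed_vector \<Rightarrow> 'b::complex_normed_vector) \<Rightarrow> 'a \<Rightarrow> bool" where
  "biholomorphic_near F p \<longleftrightarrow>
     (\<exists>A B G. open A \<and> p \<in> A \<and> open B \<and> homeomorphism A B F G \<and>
        F holomorphic_map_on A \<and> G holomorphic_map_on B)"

definition complex_dirderiv ::
    "'a::complex_normed_vector \<Rightarrow> ('a \<Rightarrow> complex) \<Rightarrow> 'a \<Rightarrow> complex" where
  "complex_dirderiv v F x = deriv (\<lambda>t. F (x + t *\<^sub>C v)) 0"


section \<open>Real analytic hypersurfaces\<close>

definition real_analytic_at :: "('a::euclidean_space \<Rightarrow> real) \<Rightarrow> 'a \<Rightarrow> bool" where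
  "real_analytic_at f p \<longleftrightarrow>
     (\<exists>c r. 0 < r \<and>
        (\<forall>x\<in>ball p r. ((\<lambda>\<alpha>. c \<alpha> * (\<Prod>b\<in>Basis. ((x - p) \<bullet> b) ^ \<alpha> b)) has_sum f x)
                       {\<alpha> :: 'a \<Rightarrow> nat. {b. \<alpha> b \<noteq> 0} \<subseteq> Basis}))"

definition real_analytic_hypersurface :: "'a::euclidean_space set \<Rightarrow> bool" where
  "real_analytic_hypersurface M \<longleftrightarrow>
     (\<forall>p\<in>M. \<exists>U \<rho> D. open U \<and> p \<in> U \<and> (\<forall>x\<in>U. real_analytic_at \<rho> x) \<and>
        (\<rho> has_derivative D) (at p) \<and> D \<noteq> (\<lambda>_. 0) \<and> M \<inter> U = {x\<in>U. \<rho> x = 0})"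


section \<open>Normal coordinates and complexification\<close>

text \<open>
  \<open>'n pt\<close> is the space of the points \<open>Z = (z, w)\<close> and \<open>\<zeta> = (\<xi>, \<tau>)\<close>, of complex dimension
  \<open>n + 1\<close> with \<open>n = CARD('n)\<close>; \<open>'n Qdom\<close> is the space of the arguments \<open>(z, \<xi>, \<tau>)\<close> of \<open>Q\<close>
  (\<open>\<xi>\<close> stands for chi, which is reserved for vector abstraction).
  Identities and inclusions that the mathematics asserts near \<open>0\<close> are stated with
  \<open>eventually _ (nhds 0)\<close>, that is, as identities of germs at \<open>0\<close>.
\<close>

type_synonym 'n pt = "(complex, 'n) vec \<times> complex"
type_synonym 'n Qdom = "(complex, 'n) vec \<times> (complex, 'n) vec \<times> complex"

definition vcnj :: "complex ^ 'n \<Rightarrow> complex ^ 'n" where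
  "vcnj z = (\<chi> i. cnj (z $ i))"

definition conj_fun ::
    "(('n::finite) Qdom \<Rightarrow> complex) \<Rightarrow> 'n Qdom \<Rightarrow> complex" where
  "conj_fun \<phi> = (\<lambda>(x, y, t). cnj (\<phi> (vcnj x, vcnj y, cnj t)))"

definition normal_coordinates ::
    "('n::finite) pt set \<Rightarrow> 'n Qdom set \<Rightarrow> ('n Qdom \<Rightarrow> complex) \<Rightarrow> bool" where
  "normal_coordinates M V Q \<longleftrightarrow>
     open V \<and> 0 \<in> V \<and> Q holomorphic_map_on V \<and>
     (\<forall>\<^sub>F (z, w) in nhds 0. (z, w) \<in> M \<longleftrightarrow> w = Q (z, vcnj z, cnj w)) \<and>
     (\<forall>\<^sub>F (\<xi>, \<tau>) in nhds 0. Q (0, \<xi>, \<tau>) = \<tau>) \<and>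
     (\<forall>\<^sub>F (z, \<tau>) in nhds 0. Q (z, 0, \<tau>) = \<tau>) \<and>
     (\<forall>\<^sub>F (z, \<xi>, w) in nhds 0. Q (z, \<xi>, conj_fun Q (\<xi>, z, w)) = w)"

definition complexification ::
    "('n::finite) Qdom set \<Rightarrow> ('n Qdom \<Rightarrow> complex) \<Rightarrow> ('n pt \<times> 'n pt) set" where
  "complexification V Q = {((z, w), (\<xi>, \<tau>)). (z, \<xi>, \<tau>) \<in> V \<and> w = Q (z, \<xi>, \<tau>)}"


section \<open>Generic rank and holomorphic nondegeneracy\<close>

definition coord_vec :: "('n::finite) option \<Rightarrow> 'n pt" where
  "coord_vec k = (case k of Some j \<Rightarrow> (axis j 1, 0) | None \<Rightarrow> (0, 1))"

text \<open>
  The minor of the Jacobian matrix of the map with components \<open>\<phi> i\<close> on the columns \<open>C\<close> and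
  the rows \<open>\<rho> ` C\<close>, up to sign: \<open>\<rho>\<close> is injective on \<open>C\<close> and matches rows with columns, which
  avoids ordering them.
\<close>

definition jacobian_minor ::
    "('i \<Rightarrow> ('n::finite) pt \<Rightarrow> complex) \<Rightarrow> 'n option set \<Rightarrow> ('n option \<Rightarrow> 'i) \<Rightarrow>
     'n pt \<Rightarrow> complex" where
  "jacobian_minor \<phi> C \<rho> Z =
     (\<Sum>\<pi> | \<pi> permutes C.
        of_int (sign \<pi>) * (\<Prod>k\<in>C. complex_dirderiv (coord_vec (\<pi> k)) (\<phi> (\<rho> k)) Z))"

definition generic_rank ::
    "'i set \<Rightarrow> ('i \<Rightarrow> ('n::finite) pt \<Rightarrow> complex) \<Rightarrow> nat" where
  "generic_rank I \<phi> =
     (GREATEST r. \<exists>C \<rho>. card C = r \<and> inj_on \<rho> C \<and> \<rho> ` C \<subseteq> I \<and>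
        \<not> (\<forall>\<^sub>F Z in nhds 0. jacobian_minor \<phi> C \<rho> Z = 0))"

text \<open>
  The derivative of order \<open>\<alpha>\<close> in \<open>z\<close>, for a multi-index \<open>\<alpha>\<close>. The list enumerates the successive
  differentiations; at points near which \<open>Q\<close> is holomorphic its order is irrelevant.
\<close>

definition z_deriv ::
    "('n::finite \<Rightarrow> nat) \<Rightarrow> ('n Qdom \<Rightarrow> complex) \<Rightarrow> 'n Qdom \<Rightarrow> complex" where
  "z_deriv \<alpha> Q = foldr (\<lambda>j. complex_dirderiv (axis j 1, 0, 0))
                   (SOME js. \<forall>j. count_list js j = \<alpha> j) Q"

definition holomorphically_nondegenerate ::
    "(('n::finite) Qdom \<Rightarrow> complex) \<Rightarrow> bool" where
  "holomorphically_nondegenerate Q \<longleftrightarrow>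
     (\<exists>K. generic_rank {\<alpha> :: 'n \<Rightarrow> nat. (\<Sum>j\<in>UNIV. \<alpha> j) \<le> K}
            (\<lambda>\<alpha> (\<xi>, \<tau>). z_deriv \<alpha> Q (0, \<xi>, \<tau>)) = CARD('n) + 1)"


section \<open>Holomorphic Segre preserving maps\<close>

text \<open>
  The map \<open>(Z, \<zeta>) \<mapsto> (H Z, Ht \<zeta>)\<close> is \<open>map_prod H Ht\<close>, with domain of definition \<open>D\<close>.
\<close>

definition HSPM ::
    "(('n::finite) pt \<times> 'n pt) set \<Rightarrow> ('n pt \<Rightarrow> 'n pt) \<Rightarrow> ('n pt \<Rightarrow> 'n pt) \<Rightarrow>
     ('n pt \<times> 'n pt) set \<Rightarrow> ('n pt \<times> 'n pt) set \<Rightarrow> bool" where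
  "HSPM D H Ht \<M> \<M>' \<longleftrightarrow>
     open D \<and> 0 \<in> D \<and> map_prod H Ht holomorphic_map_on D \<and>
     map_prod H Ht 0 = 0 \<and>
     (\<forall>\<^sub>F p in nhds 0. p \<in> \<M> \<longrightarrow> map_prod H Ht p \<in> \<M>')"

definition transversally_null ::
    "(('n::finite) pt \<Rightarrow> 'n pt) \<Rightarrow> ('n pt \<Rightarrow> 'n pt) \<Rightarrow> bool" where
  "transversally_null H Ht \<longleftrightarrow>
     (\<forall>\<^sub>F Z in nhds 0. snd (H Z) = 0) \<and> (\<forall>\<^sub>F \<zeta> in nhds 0. snd (Ht \<zeta>) = 0)"

end

theory Submission
  imports Defs "HOL-Complex_Analysis.Conformal_Mappings"
begin

text \<open>
  Write \<open>Z = (z, w)\<close> and \<open>\<zeta> = (\<xi>, \<tau>)\<close>, and let \<open>defect (Z, \<zeta>) = g Z - Q' (f Z, Ht \<zeta>)\<close> be the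
  defining function of the target hypersurface composed with the map, where \<open>H = (f, g)\<close>. It
  vanishes on the source hypersurface \<open>w = Q (z, \<zeta>)\<close>. The two cases of the theorem are whether it
  vanishes identically.

  If it does, then normal coordinates force the first case: at \<open>\<zeta> = 0\<close> the equation \<open>defect = 0\<close> reads
  \<open>g Z = Q' (f Z, 0) = 0\<close>, and at \<open>Z = 0\<close> it reads \<open>Q' (0, Ht \<zeta>) = 0\<close>, where the left side is the
  last component of \<open>Ht \<zeta>\<close>.

  The heart of the proof is \<open>vanishes_off_hypersurface\<close>: if a nontrivial holomorphic vector field in
  \<open>\<zeta>\<close> alone annihilates a function that vanishes on the source, then this function vanishes
  identically. Otherwise it has some finite order of vanishing along the hypersurface, and then the
  field has to be tangent to it, that is, annihilate \<open>Q\<close>, which holomorphic nondegeneracy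
  excludes (\<open>no_annihilating_field_if_nondegenerate\<close>). Because the hypersurface is real, it is also the
  graph of \<open>\<tau>\<close> over \<open>(\<xi>, Z)\<close> given by the conjugate of \<open>Q\<close>, so the same holds for vector
  fields in \<open>Z\<close>.

  Vector fields that annihilate the defect come from every failure of the second case. If the
  Jacobian determinant of \<open>H\<close> vanishes identically, then a field in the kernel of its derivative will do
  (\<open>kernel_field_exists\<close>). If that of \<open>Ht\<close> vanishes identically or \<open>Q'\<close> is degenerate, then the
  \<open>z\<close>-derivatives of \<open>Q'\<close> at \<open>(0, Ht \<zeta>)\<close> have generic rank at most \<open>n\<close> as functions of \<open>\<zeta>\<close>; a field
  annihilating all of them annihilates \<open>Q' (z, Ht \<zeta>)\<close> for every \<open>z\<close> (\<open>annihilating_field_pullback\<close>).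
  Hence, if the defect is not identically zero, then \<open>Q'\<close> is nondegenerate and both Jacobian
  determinants are nonzero germs. They are then simultaneously nonzero at points of the hypersurface
  arbitrarily close to \<open>0\<close>, and there the inverse function theorem applies.

  These arguments rest on four facts about holomorphic functions of several variables:
  directional derivatives are again holomorphic, they commute, a holomorphic function on a convex open
  set is determined by its germ at a point, and a product of nonzero functions is nonzero there. The
  first two follow from Cauchy's formula in complex lines, the others by restriction to complex lines.
\<close>

section \<open>Complex derivatives\<close>

definition has_complex_derivative ::
    "('a::complex_normed_vector \<Rightarrow> 'b::complex_normed_vector) \<Rightarrow> ('a \<Rightarrow> 'b) \<Rightarrow> 'a \<Rightarrow> bool" where
  "has_complex_derivative F L x \<longleftrightarrow>
     (F has_derivative L) (at x) \<and> (\<forall>c v. L (c *\<^sub>C v) = c *\<^sub>C L v)"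

lemma holomorphic_map_on_iff:
  "F holomorphic_map_on S \<longleftrightarrow> (\<forall>x\<in>S. \<exists>L. has_complex_derivative F L x)"
  by (simp add: holomorphic_map_on_def has_complex_derivative_def)

lemma holomorphic_map_on_subset: "F holomorphic_map_on S \<Longrightarrow> T \<subseteq> S \<Longrightarrow> F holomorphic_map_on T"
  by (auto simp: holomorphic_map_on_def)

lemma bounded_bilinear_scaleC:
  "bounded_bilinear (scaleC :: complex \<Rightarrow> 'a \<Rightarrow> 'a::complex_normed_vector)"
proof
  fix a a' :: complex and b b' :: 'a and r :: real
  show "(r *\<^sub>R a) *\<^sub>C b = r *\<^sub>R a *\<^sub>C b"
    by (simp add: scaleC_scaleC [symmetric] scaleC_of_real scaleR_conv_of_real)
  show "a *\<^sub>C r *\<^sub>R b = r *\<^sub>R a *\<^sub>C b"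
    by (simp add: scaleC_scaleC scaleC_of_real [symmetric] mult.commute)
  show "\<exists>K. \<forall>a (b::'a). norm (a *\<^sub>C b) \<le> norm a * norm b * K"
    by (rule exI [of _ 1]) (simp add: norm_scaleC)
qed (simp_all add: scaleC_add_right scaleC_add_left)

lemmas continuous_on_scaleC [continuous_intros] =
  bounded_bilinear.continuous_on [OF bounded_bilinear_scaleC]

lemma scaleC_zero_left [simp]: "0 *\<^sub>C v = (0::'a::complex_normed_vector)"
  and scaleC_zero_right [simp]: "c *\<^sub>C (0::'a::complex_normed_vector) = 0"
  and scaleC_one [simp]: "1 *\<^sub>C v = (v::'a)"
  using bounded_bilinear.zero_left [OF bounded_bilinear_scaleC]
    bounded_bilinear.zero_right [OF bounded_bilinear_scaleC] scaleC_of_real [of 1]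
  by auto

lemma bounded_linear_scaleC_left:
  "bounded_linear (\<lambda>c. c *\<^sub>C (v::'a::complex_normed_vector))"
  by (rule bounded_bilinear.bounded_linear_left [OF bounded_bilinear_scaleC])

lemma fst_scaleC [simp]: "fst (c *\<^sub>C x) = c *\<^sub>C fst x"
  and snd_scaleC [simp]: "snd (c *\<^sub>C x) = c *\<^sub>C snd x"
  and scaleC_Pair [simp]: "c *\<^sub>C (a, b) = (c *\<^sub>C a, c *\<^sub>C b)"
  and scaleC_vec_nth [simp]: "(c *\<^sub>C z) $ i = c *\<^sub>C (z $ i)"
  and scaleC_complex [simp]: "c *\<^sub>C d = c * (d :: complex)"
  by (simp_all add: scaleC_prod_def scaleC_vec_def scaleC_complex_def)

lemma has_complex_derivative_bounded_linear:
  assumes "bounded_linear L" "\<And>c v. L (c *\<^sub>C v) = c *\<^sub>C L v"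
  shows "has_complex_derivative L L x"
  using assms by (simp add: has_complex_derivative_def bounded_linear_imp_has_derivative)

lemma has_complex_derivative_const: "has_complex_derivative (\<lambda>_. c) (\<lambda>_. 0) x"
  by (simp add: has_complex_derivative_def)

lemma has_complex_derivative_compose:
  assumes "has_complex_derivative F L x" "has_complex_derivative G L' (F x)"
  shows "has_complex_derivative (\<lambda>x. G (F x)) (\<lambda>v. L' (L v)) x"
  using assms unfolding has_complex_derivative_def by (auto intro: has_derivative_compose)

lemma has_complex_derivative_Pair:
  assumes "has_complex_derivative F L x" "has_complex_derivative G L' x"
  shows "has_complex_derivative (\<lambda>x. (F x, G x)) (\<lambda>v. (L v, L' v)) x"
  using assms unfolding has_complex_derivative_def by (auto intro: has_derivative_Pair)

lemma has_complex_derivative_add: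
  assumes "has_complex_derivative F L x" "has_complex_derivative G L' x"
  shows "has_complex_derivative (\<lambda>x. F x + G x) (\<lambda>v. L v + L' v) x"
  using assms unfolding has_complex_derivative_def
  by (auto intro: has_derivative_add simp: scaleC_add_right)

lemma has_complex_derivative_diff:
  fixes F G :: "'a::complex_normed_vector \<Rightarrow> complex"
  assumes "has_complex_derivative F L x" "has_complex_derivative G L' x"
  shows "has_complex_derivative (\<lambda>x. F x - G x) (\<lambda>v. L v - L' v) x"
  using assms unfolding has_complex_derivative_def
  by (auto intro: has_derivative_diff simp: right_diff_distrib)

lemma has_complex_derivative_at_0:
  assumes "has_complex_derivative F L x" shows "L 0 = 0"
proof -
  have "L (0 *\<^sub>C 0) = 0 *\<^sub>C L 0" using assms unfolding has_complex_derivative_def by blast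
  then show ?thesis by simp
qed

lemma has_complex_derivative_scaleC:
  fixes G :: "_ \<Rightarrow> 'b::complex_normed_vector"
  assumes "has_complex_derivative F L x" "has_complex_derivative G L' x"
  shows "has_complex_derivative (\<lambda>x. F x *\<^sub>C G x) (\<lambda>v. F x *\<^sub>C L' v + L v *\<^sub>C G x) x"
  using assms bounded_bilinear.FDERIV [OF bounded_bilinear_scaleC, of F L x UNIV G L']
  unfolding has_complex_derivative_def
  by (auto simp: scaleC_add_right scaleC_scaleC mult.commute)

lemma holomorphic_map_on_const: "(\<lambda>_. c) holomorphic_map_on S"
  unfolding holomorphic_map_on_iff using has_complex_derivative_const by blast

lemma holomorphic_map_on_bounded_linear:
  assumes "bounded_linear L" "\<And>c v. L (c *\<^sub>C v) = c *\<^sub>C L v"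
  shows "L holomorphic_map_on S"
  unfolding holomorphic_map_on_iff using has_complex_derivative_bounded_linear [OF assms] by blast

lemma holomorphic_map_on_ident: "(\<lambda>x. x) holomorphic_map_on S"
  by (rule holomorphic_map_on_bounded_linear) (auto simp: bounded_linear_ident)

lemma holomorphic_map_on_compose:
  assumes "F holomorphic_map_on S" "G holomorphic_map_on T" "\<And>x. x \<in> S \<Longrightarrow> F x \<in> T"
  shows "(\<lambda>x. G (F x)) holomorphic_map_on S"
  using assms unfolding holomorphic_map_on_iff by (blast intro: has_complex_derivative_compose)

lemma holomorphic_map_on_Pair:
  assumes "F holomorphic_map_on S" "G holomorphic_map_on S"
  shows "(\<lambda>x. (F x, G x)) holomorphic_map_on S"
  using assms unfolding holomorphic_map_on_iff by (blast intro: has_complex_derivative_Pair)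

lemma holomorphic_map_on_add:
  assumes "F holomorphic_map_on S" "G holomorphic_map_on S"
  shows "(\<lambda>x. F x + G x) holomorphic_map_on S"
  using assms unfolding holomorphic_map_on_iff by (blast intro: has_complex_derivative_add)

lemma holomorphic_map_on_scaleC:
  assumes "F holomorphic_map_on S" "G holomorphic_map_on S"
  shows "(\<lambda>x. F x *\<^sub>C G x) holomorphic_map_on S"
  using assms unfolding holomorphic_map_on_iff by (blast intro: has_complex_derivative_scaleC)

lemma holomorphic_map_on_mult:
  fixes F G :: "_ \<Rightarrow> complex"
  assumes "F holomorphic_map_on S" "G holomorphic_map_on S"
  shows "(\<lambda>x. F x * G x) holomorphic_map_on S"
  using holomorphic_map_on_scaleC [OF assms] by simp

lemma holomorphic_map_on_fst:
  "F holomorphic_map_on S \<Longrightarrow> (\<lambda>x. fst (F x)) holomorphic_map_on S"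
  by (rule holomorphic_map_on_compose [of F S fst UNIV])
    (auto intro!: holomorphic_map_on_bounded_linear bounded_linear_fst)

lemma holomorphic_map_on_snd:
  "F holomorphic_map_on S \<Longrightarrow> (\<lambda>x. snd (F x)) holomorphic_map_on S"
  by (rule holomorphic_map_on_compose [of F S snd UNIV])
    (auto intro!: holomorphic_map_on_bounded_linear bounded_linear_snd)

lemma holomorphic_map_on_vec_nth:
  "F holomorphic_map_on S \<Longrightarrow> (\<lambda>x. F x $ i) holomorphic_map_on S"
  by (rule holomorphic_map_on_compose [of F S "\<lambda>z. z $ i" UNIV])
    (auto intro!: holomorphic_map_on_bounded_linear bounded_linear_vec_nth)

lemma holomorphic_map_on_sum:
  assumes "\<And>i. i \<in> I \<Longrightarrow> F i holomorphic_map_on S"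
  shows "(\<lambda>x. \<Sum>i\<in>I. F i x) holomorphic_map_on S"
  using assms
proof (induction I rule: infinite_finite_induct)
  case (insert i I)
  then show ?case by (auto intro: holomorphic_map_on_add)
qed (auto intro: holomorphic_map_on_const)

lemma holomorphic_map_on_prod:
  fixes F :: "_ \<Rightarrow> _ \<Rightarrow> complex"
  assumes "\<And>i. i \<in> I \<Longrightarrow> F i holomorphic_map_on S"
  shows "(\<lambda>x. \<Prod>i\<in>I. F i x) holomorphic_map_on S"
  using assms
proof (induction I rule: infinite_finite_induct)
  case (insert i I)
  then show ?case by (auto intro: holomorphic_map_on_mult)
qed (auto intro: holomorphic_map_on_const)

lemma holomorphic_map_on_diff:
  fixes F G :: "_ \<Rightarrow> complex"
  assumes "F holomorphic_map_on S" "G holomorphic_map_on S"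
  shows "(\<lambda>x. F x - G x) holomorphic_map_on S"
  using holomorphic_map_on_add [OF assms(1) holomorphic_map_on_mult
      [OF holomorphic_map_on_const [of "-1"] assms(2)]] by simp

lemma holomorphic_map_on_imp_continuous_on:
  "F holomorphic_map_on S \<Longrightarrow> continuous_on S F"
  unfolding holomorphic_map_on_def
  by (meson continuous_at_imp_continuous_on has_derivative_continuous)

section \<open>Directional derivatives\<close>

lemma has_complex_derivative_along_line:
  assumes "has_complex_derivative F L (x + t *\<^sub>C v)"
  shows "((\<lambda>t. F (x + t *\<^sub>C v) :: complex) has_field_derivative L v) (at t)"
proof -
  have "((\<lambda>t. x + t *\<^sub>C v) has_derivative (\<lambda>t. 0 + t *\<^sub>C v)) (at t)"
    by (intro has_derivative_add has_derivative_const
        bounded_linear_imp_has_derivative bounded_linear_scaleC_left)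
  moreover have "(F has_derivative L) (at (x + t *\<^sub>C v))"
    using assms by (simp only: has_complex_derivative_def)
  ultimately have "((\<lambda>t. F (x + t *\<^sub>C v)) has_derivative (\<lambda>t. L (0 + t *\<^sub>C v))) (at t)"
    by (rule has_derivative_compose)
  moreover have "L (0 + t *\<^sub>C v) = L v * t" for t
    using assms by (simp add: has_complex_derivative_def)
  ultimately show ?thesis by (simp add: has_field_derivative_def)
qed

lemma complex_dirderiv_eq:
  assumes "has_complex_derivative F L x"
  shows "complex_dirderiv v F x = L v"
proof -
  have "has_complex_derivative F L (x + 0 *\<^sub>C v)" using assms by simp
  then show ?thesis
    unfolding complex_dirderiv_def by (intro DERIV_imp_deriv has_complex_derivative_along_line)
qed

lemma has_complex_derivative_dirderiv:
  assumes "F holomorphic_map_on S" "x \<in> S"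
  shows "has_complex_derivative F (\<lambda>v. complex_dirderiv v F x) x"
proof -
  obtain L where L: "has_complex_derivative F L x"
    using assms unfolding holomorphic_map_on_iff by blast
  then have "(\<lambda>v. complex_dirderiv v F x) = L"
    by (intro ext) (rule complex_dirderiv_eq)
  with L show ?thesis by (simp only:)
qed

lemma has_field_derivative_along_line:
  assumes "F holomorphic_map_on S" "x + t *\<^sub>C v \<in> S"
  shows "((\<lambda>t. F (x + t *\<^sub>C v)) has_field_derivative complex_dirderiv v F (x + t *\<^sub>C v)) (at t)"
  by (rule has_complex_derivative_along_line [OF has_complex_derivative_dirderiv [OF assms]])

lemma holomorphic_on_along_line:
  assumes "F holomorphic_map_on S" "\<And>t. t \<in> T \<Longrightarrow> x + t *\<^sub>C v \<in> S"
  shows "(\<lambda>t. F (x + t *\<^sub>C v)) holomorphic_on T"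
  unfolding holomorphic_on_def field_differentiable_def
proof
  fix t assume "t \<in> T"
  then have "x + t *\<^sub>C v \<in> S" by (rule assms(2))
  note has_field_derivative_at_within [OF has_field_derivative_along_line [OF assms(1) this], of T]
  then show "\<exists>f'. ((\<lambda>t. F (x + t *\<^sub>C v)) has_field_derivative f') (at t within T)" ..
qed

lemma eventually_line:
  assumes "\<forall>\<^sub>F y in nhds x. P y"
  shows "\<forall>\<^sub>F t in nhds 0. P (x + t *\<^sub>C v)"
proof -
  have "continuous_on UNIV (\<lambda>t. x + t *\<^sub>C v)" by (intro continuous_intros)
  then have "((\<lambda>t. x + t *\<^sub>C v) \<longlongrightarrow> x + 0 *\<^sub>C v) (at 0)"
    unfolding continuous_on_def by blast
  then have "((\<lambda>t. x + t *\<^sub>C v) \<longlongrightarrow> x + 0 *\<^sub>C v) (nhds 0)"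
    by (rule tendsto_at_iff_tendsto_nhds [where g = "\<lambda>t. x + t *\<^sub>C v", THEN iffD1])
  then have "filterlim (\<lambda>t. x + t *\<^sub>C v) (nhds x) (nhds 0)" by simp
  with assms show ?thesis by (rule eventually_compose_filterlim)
qed

lemma complex_dirderiv_cong_ev:
  assumes "\<forall>\<^sub>F y in nhds x. F y = G y"
  shows "complex_dirderiv v F x = complex_dirderiv v G x"
  unfolding complex_dirderiv_def by (rule deriv_cong_ev [OF eventually_line [OF assms] refl])

lemma complex_dirderiv_cong_open:
  assumes "open S" "x \<in> S" "\<And>y. y \<in> S \<Longrightarrow> F y = G y"
  shows "complex_dirderiv v F x = complex_dirderiv v G x"
  using assms by (intro complex_dirderiv_cong_ev) (auto simp: eventually_nhds)

lemma complex_dirderiv_linear: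
  assumes "F holomorphic_map_on S" "x \<in> S"
  shows "complex_dirderiv (u + v) F x = complex_dirderiv u F x + complex_dirderiv v F x"
    and "complex_dirderiv (c *\<^sub>C v) F x = c * complex_dirderiv v F x"
    and "complex_dirderiv 0 F x = 0"
    and "complex_dirderiv (\<Sum>i\<in>I. w i) F x = (\<Sum>i\<in>I. complex_dirderiv (w i) F x)"
proof -
  have D: "has_complex_derivative F (\<lambda>v. complex_dirderiv v F x) x"
    using assms by (rule has_complex_derivative_dirderiv)
  then have lin: "bounded_linear (\<lambda>v. complex_dirderiv v F x)"
    by (auto simp: has_complex_derivative_def has_derivative_bounded_linear)
  show "complex_dirderiv (u + v) F x = complex_dirderiv u F x + complex_dirderiv v F x"
    "complex_dirderiv 0 F x = 0"
    "complex_dirderiv (\<Sum>i\<in>I. w i) F x = (\<Sum>i\<in>I. complex_dirderiv (w i) F x)"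
    using linear_add [OF bounded_linear.linear [OF lin]] linear_0 [OF bounded_linear.linear [OF lin]]
      linear_sum [OF bounded_linear.linear [OF lin], of w I] by simp_all
  show "complex_dirderiv (c *\<^sub>C v) F x = c * complex_dirderiv v F x"
    using D by (simp add: has_complex_derivative_def)
qed

lemma complex_dirderiv_compose:
  assumes "has_complex_derivative F L x" "G holomorphic_map_on T" "F x \<in> T"
  shows "complex_dirderiv v (\<lambda>x. G (F x)) x = complex_dirderiv (L v) G (F x)"
  by (rule complex_dirderiv_eq)
    (rule has_complex_derivative_compose [OF assms(1)
        has_complex_derivative_dirderiv [OF assms(2,3)]])

section \<open>Derivatives of holomorphic functions are holomorphic\<close>

abbreviation circ :: "real \<Rightarrow> real \<Rightarrow> complex" where
  "circ \<rho> s \<equiv> circlepath 0 \<rho> s"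

lemma norm_circ: "0 < \<rho> \<Longrightarrow> cmod (circ \<rho> s) = \<rho>"
  by (simp add: circlepath norm_mult)

text \<open>Cauchy's formula on the circle of radius \<open>\<rho>\<close> in the complex line through \<open>x\<close> with direction
  \<open>v\<close>. It turns differentiation in \<open>v\<close> into integration, which preserves regularity in \<open>x\<close>.\<close>

lemma complex_dirderiv_Cauchy:
  assumes "F holomorphic_map_on S" "0 < \<rho>" "\<And>t. cmod t \<le> \<rho> \<Longrightarrow> x + t *\<^sub>C v \<in> S"
  shows "complex_dirderiv v F x =
    integral (cbox 0 1) (\<lambda>s. F (x + circ \<rho> s *\<^sub>C v) / circ \<rho> s)"
proof -
  let ?f = "\<lambda>t. F (x + t *\<^sub>C v)"
  have hol: "?f holomorphic_on cball 0 \<rho>"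
    using assms by (intro holomorphic_on_along_line) auto
  have circ0: "circ \<rho> s \<noteq> 0" for s
    using norm_circ [OF \<open>0 < \<rho>\<close>] \<open>0 < \<rho>\<close> by (metis norm_zero less_irrefl)
  have vd: "vector_derivative (circlepath 0 \<rho>) (at s) = (2 * of_real pi * \<i>) * circ \<rho> s" for s
    by (subst vector_derivative_at [OF has_vector_derivative_circlepath]) (simp add: circlepath)
  have "complex_dirderiv v F x =
      1 / (2 * of_real pi * \<i>) * contour_integral (circlepath 0 \<rho>) (\<lambda>u. ?f u / (u - 0)^2)"
    unfolding complex_dirderiv_def
    by (intro DERIV_imp_deriv Cauchy_derivative_integral_circlepath holomorphic_on_imp_continuous_on
        hol holomorphic_on_subset [OF hol]) (use assms in auto)
  also have "\<dots> = 1 / (2 * of_real pi * \<i>) *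
      integral {0..1} (\<lambda>s. (2 * of_real pi * \<i>) * (?f (circ \<rho> s) / circ \<rho> s))"
    unfolding contour_integral_integral
    by (rule arg_cong [OF integral_cong])
      (use circ0 in \<open>simp add: vd power2_eq_square\<close>)
  also have "\<dots> = integral (cbox 0 1) (\<lambda>s. ?f (circ \<rho> s) / circ \<rho> s)"
    by (subst integral_mult_right) (simp add: cbox_interval)
  finally show ?thesis .
qed

text \<open>One radius serves for all centres near \<open>x\<close>, so the Cauchy integral can be differentiated with
  respect to the centre.\<close>

lemma uniform_circle_radius:
  fixes v :: "'a::complex_normed_vector"
  assumes "open S" "x \<in> S"
  obtains \<rho> \<delta> where "0 < \<rho>" "0 < \<delta>" "ball x \<delta> \<subseteq> S"
    "\<And>y t. y \<in> ball x \<delta> \<Longrightarrow> cmod t \<le> \<rho> \<Longrightarrow> y + t *\<^sub>C v \<in> S"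
proof -
  obtain e where e: "0 < e" "ball x e \<subseteq> S" using assms open_contains_ball by blast
  \<comment> \<open>\<open>norm v + 1\<close> instead of \<open>norm v\<close> covers \<open>v = 0\<close>\<close>
  define \<rho> where "\<rho> = e / (2 * (norm v + 1))"
  have \<rho>: "0 < \<rho>" using e by (simp add: \<rho>_def add_nonneg_pos)
  have "y + t *\<^sub>C v \<in> S" if "y \<in> ball x (e/2)" "cmod t \<le> \<rho>" for y t
  proof -
    have "norm (t *\<^sub>C v) \<le> \<rho> * norm v"
      unfolding norm_scaleC using that by (simp add: mult_right_mono)
    also have "\<dots> \<le> \<rho> * (norm v + 1)" using \<rho> by (simp add: mult_left_mono)
    also have "\<dots> = e/2" by (simp add: \<rho>_def field_simps add_nonneg_eq_0_iff)
    finally have "norm (t *\<^sub>C v) \<le> e/2" .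
    moreover have "dist x (y + t *\<^sub>C v) \<le> dist x y + norm (t *\<^sub>C v)"
      using dist_triangle [of x "y + t *\<^sub>C v" y] by (simp add: dist_norm)
    ultimately have "y + t *\<^sub>C v \<in> ball x e" using that by simp
    with e show ?thesis by blast
  qed
  moreover have "ball x (e/2) \<subseteq> S" using e subset_ball [of "e/2" e x] by auto
  ultimately show ?thesis using that [of \<rho> "e/2"] \<rho> e by auto
qed

lemma continuous_on_circle:
  fixes v :: "'a::complex_normed_vector"
  assumes "continuous_on S F" "0 < \<rho>" "\<And>y s. y \<in> T \<Longrightarrow> y + circ \<rho> s *\<^sub>C v \<in> S"
  shows "continuous_on (T \<times> cbox 0 1) (\<lambda>(y, s). F (y + circ \<rho> s *\<^sub>C v))"
proof -
  have "continuous_on (T \<times> cbox 0 1) (\<lambda>p. F (fst p + circ \<rho> (snd p) *\<^sub>C v))"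
    unfolding circlepath
    by (rule continuous_on_compose2 [OF assms(1)]) (use assms(3) in
       \<open>auto intro!: continuous_intros simp: circlepath\<close>)
  then show ?thesis by (simp add: case_prod_unfold)
qed

lemma continuous_on_complex_dirderiv:
  assumes "F holomorphic_map_on S" "open S"
  shows "continuous_on S (complex_dirderiv v F)"
proof -
  have "isCont (complex_dirderiv v F) x" if x: "x \<in> S" for x
  proof -
    obtain \<rho> \<delta> where r: "0 < \<rho>" "0 < \<delta>" "\<And>y t. y \<in> ball x \<delta> \<Longrightarrow> cmod t \<le> \<rho> \<Longrightarrow> y + t *\<^sub>C v \<in> S"
      using uniform_circle_radius [OF assms(2) x] by metis
    have "continuous_on (ball x \<delta> \<times> cbox 0 1) (\<lambda>(y, s). F (y + circ \<rho> s *\<^sub>C v))"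
      by (rule continuous_on_circle [OF holomorphic_map_on_imp_continuous_on [OF assms(1)]])
        (use r norm_circ in auto)
    then have "continuous_on (ball x \<delta> \<times> cbox 0 1) (\<lambda>p. F (fst p + circ \<rho> (snd p) *\<^sub>C v) / circ \<rho> (snd p))"
      using r by (auto simp: case_prod_unfold circlepath intro!: continuous_intros)
    then have "continuous_on (ball x \<delta>) (\<lambda>y. integral (cbox 0 1) (\<lambda>s. F (y + circ \<rho> s *\<^sub>C v) / circ \<rho> s))"
      by (intro integral_continuous_on_param) (simp add: case_prod_unfold)
    then have "continuous_on (ball x \<delta>) (complex_dirderiv v F)"
      by (rule continuous_on_eq) (rule complex_dirderiv_Cauchy [OF assms(1) r(1) r(3), symmetric])
    then show ?thesis using r(2) by (simp add: continuous_on_eq_continuous_at)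
  qed
  then show ?thesis by (simp add: continuous_at_imp_continuous_on)
qed

text \<open>In finite dimension, continuity in every direction is continuity of the derivative in the
  operator norm, which differentiation under the integral sign requires.\<close>

lemma continuous_on_Blinfun_dirderiv:
  fixes F :: "'a::{complex_normed_vector,euclidean_space} \<Rightarrow> complex"
  assumes "F holomorphic_map_on S" "open S"
  shows "continuous_on S (\<lambda>x. Blinfun (\<lambda>v. complex_dirderiv v F x))"
    and "x \<in> S \<Longrightarrow> blinfun_apply (Blinfun (\<lambda>v. complex_dirderiv v F x)) =
      (\<lambda>v. complex_dirderiv v F x)"
proof -
  show *: "blinfun_apply (Blinfun (\<lambda>v. complex_dirderiv v F x)) = (\<lambda>v. complex_dirderiv v F x)"
    if "x \<in> S" for x
    using has_complex_derivative_dirderiv [OF assms(1) that]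
    by (intro bounded_linear_Blinfun_apply)
      (auto simp: has_complex_derivative_def has_derivative_bounded_linear)
  show "continuous_on S (\<lambda>x. Blinfun (\<lambda>v. complex_dirderiv v F x))"
    by (intro continuous_on_blinfun_componentwise
        continuous_on_eq [OF continuous_on_complex_dirderiv [OF assms]]) (simp add: *)
qed

text \<open>Differentiation under the integral sign in Cauchy's formula. The radius \<open>\<rho>\<close> is exposed because
  the resulting integral is again a Cauchy integral, now of the derivative of \<open>F\<close> in the direction
  \<open>h\<close>; this gives the symmetry of second derivatives below.\<close>

lemma has_complex_derivative_complex_dirderiv_integral:
  fixes F :: "'a::{complex_normed_vector,euclidean_space} \<Rightarrow> complex"
  assumes hol: "F holomorphic_map_on S" and "open S" "x \<in> S"
  obtains \<rho> where "0 < \<rho>" "\<And>t. cmod t \<le> \<rho> \<Longrightarrow> x + t *\<^sub>C v \<in> S"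
    "has_complex_derivative (complex_dirderiv v F)
      (\<lambda>h. integral (cbox 0 1) (\<lambda>s. complex_dirderiv h F (x + circ \<rho> s *\<^sub>C v) / circ \<rho> s)) x"
proof -
  obtain \<rho> \<delta> where r: "0 < \<rho>" "0 < \<delta>" "ball x \<delta> \<subseteq> S"
    "\<And>y t. y \<in> ball x \<delta> \<Longrightarrow> cmod t \<le> \<rho> \<Longrightarrow> y + t *\<^sub>C v \<in> S"
    using uniform_circle_radius [OF assms(2,3)] by metis
  have inS: "y + circ \<rho> s *\<^sub>C v \<in> S" if "y \<in> ball x \<delta>" for y s
    using r that by (auto simp: norm_circ)
  have x: "x \<in> ball x \<delta>" using r(2) by simp
  define dF where "dF = (\<lambda>x. Blinfun (\<lambda>v. complex_dirderiv v F x))"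
  have dF: "continuous_on S dF" "\<And>y. y \<in> S \<Longrightarrow> blinfun_apply (dF y) = (\<lambda>v. complex_dirderiv v F y)"
    unfolding dF_def using continuous_on_Blinfun_dirderiv [OF hol \<open>open S\<close>] by auto
  define f where "f = (\<lambda>y s. F (y + circ \<rho> s *\<^sub>C v) / circ \<rho> s)"
  define fx where "fx = (\<lambda>y s. blinfun_mult_right (1 / circ \<rho> s) o\<^sub>L dF (y + circ \<rho> s *\<^sub>C v))"
  have circ0: "circ \<rho> s \<noteq> 0" for s using norm_circ [OF r(1)] r(1) by (metis norm_zero less_irrefl)
  have cont_circ: "continuous_on A (\<lambda>p. circ \<rho> (g p))" if "continuous_on A g" for A and g :: "'b::topological_space \<Rightarrow> real"
    unfolding circlepath using that by (intro continuous_intros)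
  have fx_apply: "blinfun_apply (fx y s) h = complex_dirderiv h F (y + circ \<rho> s *\<^sub>C v) / circ \<rho> s"
    if "y \<in> ball x \<delta>" for y s h
    using dF(2) [OF inS [OF that]] by (simp add: fx_def)
  have cont_f: "continuous_on (ball x \<delta> \<times> cbox 0 1) (\<lambda>(y, s). f y s)"
    using continuous_on_circle [where T = "ball x \<delta>", OF holomorphic_map_on_imp_continuous_on [OF hol] r(1) inS]
    unfolding f_def case_prod_unfold by (intro continuous_intros cont_circ) (auto simp: circ0)
  have cont_fx: "continuous_on (ball x \<delta> \<times> cbox 0 1) (\<lambda>(y, s). fx y s)"
    using continuous_on_circle [where T = "ball x \<delta>", OF dF(1) r(1) inS]
    unfolding fx_def case_prod_unfold by (intro continuous_intros cont_circ) (auto simp: circ0)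
  have slice: "continuous_on (cbox 0 1) (\<lambda>s. G y s)"
    if "continuous_on (ball x \<delta> \<times> cbox 0 1) (\<lambda>(y, s). G y s)" "y \<in> ball x \<delta>"
    for y and G :: "'a \<Rightarrow> real \<Rightarrow> 'c::topological_space"
  proof -
    have "continuous_on (cbox 0 1) (\<lambda>s. (\<lambda>(y, s). G y s) (y, s))"
      by (rule continuous_on_compose2 [OF that(1)]) (use that in \<open>auto intro!: continuous_intros\<close>)
    then show ?thesis by simp
  qed
  have "((\<lambda>y. integral (cbox 0 1) (f y)) has_derivative integral (cbox 0 1) (fx x))
      (at x within ball x \<delta>)"
  proof (rule leibniz_rule [OF _ _ cont_fx])
    fix y and s :: real assume y: "y \<in> ball x \<delta>"
    have "((\<lambda>y. y + circ \<rho> s *\<^sub>C v) has_derivative (\<lambda>h. h + 0)) (at y)"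
      by (rule has_derivative_add [OF has_derivative_ident has_derivative_const])
    moreover have "(F has_derivative (\<lambda>h. complex_dirderiv h F (y + circ \<rho> s *\<^sub>C v)))
        (at (y + circ \<rho> s *\<^sub>C v))"
      using has_complex_derivative_dirderiv [OF hol inS [OF y]]
      by (simp only: has_complex_derivative_def)
    ultimately have "((\<lambda>y. F (y + circ \<rho> s *\<^sub>C v)) has_derivative
        (\<lambda>h. complex_dirderiv (h + 0) F (y + circ \<rho> s *\<^sub>C v))) (at y)"
      by (rule has_derivative_compose)
    from bounded_linear.has_derivative [OF bounded_linear_divide this, of "circ \<rho> s"]
    have "((\<lambda>y. f y s) has_derivative blinfun_apply (fx y s)) (at y)"
      unfolding f_def fx_apply [OF y, abs_def] by (simp only: add_0_right)
    then show "((\<lambda>y. f y s) has_derivative blinfun_apply (fx y s)) (at y within ball x \<delta>)"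
      by (rule has_derivative_at_withinI)
  next
    show "f y integrable_on cbox 0 1" if "y \<in> ball x \<delta>" for y
      by (rule integrable_continuous [OF slice [OF cont_f that]])
    show "x \<in> ball x \<delta>" using r(2) by simp
    show "convex (ball x \<delta>)" by (rule convex_ball)
  qed
  then have "((\<lambda>y. integral (cbox 0 1) (f y)) has_derivative integral (cbox 0 1) (fx x)) (at x)"
    by (simp only: at_within_open [OF x open_ball])
  then have der: "(complex_dirderiv v F has_derivative integral (cbox 0 1) (fx x)) (at x)"
  proof (rule has_derivative_transform_within_open [where s = "ball x \<delta>"])
    show "integral (cbox 0 1) (f y) = complex_dirderiv v F y" if "y \<in> ball x \<delta>" for y
      unfolding f_def by (rule complex_dirderiv_Cauchy [OF hol r(1) r(4) [OF that], symmetric])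
  qed (use x in \<open>simp_all only: open_ball\<close>)
  have eq: "blinfun_apply (integral (cbox 0 1) (fx x)) h =
      integral (cbox 0 1) (\<lambda>s. complex_dirderiv h F (x + circ \<rho> s *\<^sub>C v) / circ \<rho> s)" for h
    by (simp only: blinfun_apply_integral [OF integrable_continuous [OF slice [OF cont_fx x]]]
        fx_apply [OF x])
  have "has_complex_derivative (complex_dirderiv v F)
      (\<lambda>h. integral (cbox 0 1) (\<lambda>s. complex_dirderiv h F (x + circ \<rho> s *\<^sub>C v) / circ \<rho> s)) x"
    unfolding has_complex_derivative_def
  proof (intro conjI allI)
    show "(complex_dirderiv v F has_derivative
      (\<lambda>h. integral (cbox 0 1) (\<lambda>s. complex_dirderiv h F (x + circ \<rho> s *\<^sub>C v) / circ \<rho> s))) (at x)"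
      using der by (simp only: eq [symmetric])
    show "integral (cbox 0 1) (\<lambda>s. complex_dirderiv (c *\<^sub>C h) F (x + circ \<rho> s *\<^sub>C v) / circ \<rho> s) =
      c *\<^sub>C integral (cbox 0 1) (\<lambda>s. complex_dirderiv h F (x + circ \<rho> s *\<^sub>C v) / circ \<rho> s)" for c h
    proof -
      have "complex_dirderiv (c *\<^sub>C h) F (x + circ \<rho> s *\<^sub>C v) / circ \<rho> s =
          c * (complex_dirderiv h F (x + circ \<rho> s *\<^sub>C v) / circ \<rho> s)" for s
        using r(2) complex_dirderiv_linear(2) [OF hol inS [of x]] by simp
      then show ?thesis by (simp only: integral_mult_right scaleC_complex)
    qed
  qed
  then show ?thesis using that [of \<rho>] r by auto
qed

lemma holomorphic_map_on_complex_dirderiv: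
  fixes F :: "'a::{complex_normed_vector,euclidean_space} \<Rightarrow> complex"
  assumes "F holomorphic_map_on S" "open S"
  shows "complex_dirderiv v F holomorphic_map_on S"
  unfolding holomorphic_map_on_iff
proof
  fix x assume "x \<in> S"
  from has_complex_derivative_complex_dirderiv_integral [OF assms this, of v]
  show "\<exists>L. has_complex_derivative (complex_dirderiv v F) L x" by blast
qed

lemma complex_dirderiv_commute:
  fixes F :: "'a::{complex_normed_vector,euclidean_space} \<Rightarrow> complex"
  assumes "F holomorphic_map_on S" "open S" "x \<in> S"
  shows "complex_dirderiv h (complex_dirderiv v F) x = complex_dirderiv v (complex_dirderiv h F) x"
proof (rule has_complex_derivative_complex_dirderiv_integral [OF assms, of v])
  fix \<rho> :: real
  assume \<rho>: "0 < \<rho>" "\<And>t. cmod t \<le> \<rho> \<Longrightarrow> x + t *\<^sub>C v \<in> S"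
    "has_complex_derivative (complex_dirderiv v F)
      (\<lambda>h. integral (cbox 0 1) (\<lambda>s. complex_dirderiv h F (x + circ \<rho> s *\<^sub>C v) / circ \<rho> s)) x"
  show ?thesis
    unfolding complex_dirderiv_eq [OF \<rho>(3)]
    by (rule complex_dirderiv_Cauchy
        [OF holomorphic_map_on_complex_dirderiv [OF assms(1,2)] \<rho>(1,2), symmetric])
qed

text \<open>The direction of differentiation may vary holomorphically: \<open>complex_dirderiv (a x) F x\<close> is the
  derivative of \<open>(x, t) \<mapsto> F (x + t *\<^sub>C a x)\<close> in the fixed direction of \<open>t\<close>.\<close>

lemma holomorphic_map_on_complex_dirderiv_field:
  fixes F :: "'a::{complex_normed_vector,euclidean_space} \<Rightarrow> complex"
  assumes F: "F holomorphic_map_on S" "open S" and a: "a holomorphic_map_on S"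
  shows "(\<lambda>x. complex_dirderiv (a x) F x) holomorphic_map_on S"
proof -
  define \<Phi> where "\<Phi> = (\<lambda>p :: 'a \<times> complex. fst p + snd p *\<^sub>C a (fst p))"
  define T where "T = (S \<times> UNIV) \<inter> \<Phi> -` S"
  have "(\<lambda>p :: 'a \<times> complex. a (fst p)) holomorphic_map_on (S \<times> UNIV)"
    by (rule holomorphic_map_on_compose [OF _ a]) (auto intro!: holomorphic_map_on_fst holomorphic_map_on_ident)
  then have \<Phi>: "\<Phi> holomorphic_map_on (S \<times> UNIV)"
    unfolding \<Phi>_def
    by (intro holomorphic_map_on_add holomorphic_map_on_scaleC holomorphic_map_on_fst
        holomorphic_map_on_snd holomorphic_map_on_ident)
  have T: "open T"
    unfolding T_def by (rule continuous_open_preimage)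
      (use F(2) holomorphic_map_on_imp_continuous_on [OF \<Phi>] in \<open>auto intro!: open_Times\<close>)
  have "(\<lambda>p. F (\<Phi> p)) holomorphic_map_on T"
    by (rule holomorphic_map_on_compose [OF _ F(1)])
      (use holomorphic_map_on_subset [OF \<Phi>] in \<open>auto simp: T_def\<close>)
  then have "complex_dirderiv (0, 1) (\<lambda>p. F (\<Phi> p)) holomorphic_map_on T"
    using T by (rule holomorphic_map_on_complex_dirderiv)
  then have "(\<lambda>x. complex_dirderiv (0, 1) (\<lambda>p. F (\<Phi> p)) (x, 0)) holomorphic_map_on S"
    by (rule holomorphic_map_on_compose [rotated])
      (auto simp: T_def \<Phi>_def intro!: holomorphic_map_on_Pair holomorphic_map_on_const holomorphic_map_on_ident)
  then show ?thesis by (simp add: complex_dirderiv_def \<Phi>_def)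
qed

section \<open>Identity theorem on convex sets\<close>

lemma open_line_preimage:
  assumes "open S" shows "open {t. x + t *\<^sub>C v \<in> S}"
proof -
  have "open ((\<lambda>t. x + t *\<^sub>C v) -` S)"
    by (rule open_vimage [OF assms]) (intro continuous_intros)
  then show ?thesis by (simp add: vimage_def)
qed

lemma convex_line_preimage:
  assumes "convex S" shows "convex {t. x + t *\<^sub>C v \<in> S}"
proof (rule convexI)
  fix s t :: complex and a b :: real
  assume st: "s \<in> {t. x + t *\<^sub>C v \<in> S}" "t \<in> {t. x + t *\<^sub>C v \<in> S}" and ab: "0 \<le> a" "0 \<le> b" "a + b = 1"
  have "a *\<^sub>R (x + s *\<^sub>C v) + b *\<^sub>R (x + t *\<^sub>C v) = (a + b) *\<^sub>R x + (a *\<^sub>R s + b *\<^sub>R t) *\<^sub>C v"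
    by (simp add: scaleR_add_right scaleR_add_left scaleC_add_left
        bounded_bilinear.scaleR_left [OF bounded_bilinear_scaleC])
  then have "x + (a *\<^sub>R s + b *\<^sub>R t) *\<^sub>C v = a *\<^sub>R (x + s *\<^sub>C v) + b *\<^sub>R (x + t *\<^sub>C v)"
    using ab by simp
  with convexD [OF assms _ _ ab] st
  show "a *\<^sub>R s + b *\<^sub>R t \<in> {t. x + t *\<^sub>C v \<in> S}" by auto
qed

lemma higher_deriv_along_line:
  fixes F :: "'a::{complex_normed_vector,euclidean_space} \<Rightarrow> complex"
  assumes "F holomorphic_map_on S" "open S" "x + t *\<^sub>C v \<in> S"
  shows "(deriv ^^ k) (\<lambda>t. F (x + t *\<^sub>C v)) t = (complex_dirderiv v ^^ k) F (x + t *\<^sub>C v)"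
  using assms(1,3)
proof (induction k arbitrary: F t)
  case (Suc k)
  have "\<forall>\<^sub>F t in nhds t. t \<in> {t. x + t *\<^sub>C v \<in> S}"
    using open_line_preimage [OF \<open>open S\<close>] Suc.prems(2) by (intro eventually_nhds_in_open) auto
  then have "\<forall>\<^sub>F t in nhds t. deriv (\<lambda>t. F (x + t *\<^sub>C v)) t = complex_dirderiv v F (x + t *\<^sub>C v)"
    by (rule eventually_mono) (use has_field_derivative_along_line [OF Suc.prems(1)] DERIV_imp_deriv in blast)
  then have "(deriv ^^ k) (deriv (\<lambda>t. F (x + t *\<^sub>C v))) t =
      (deriv ^^ k) (\<lambda>t. complex_dirderiv v F (x + t *\<^sub>C v)) t"
    by (rule higher_deriv_cong_ev) simp
  also have "\<dots> = (complex_dirderiv v ^^ k) (complex_dirderiv v F) (x + t *\<^sub>C v)"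
    by (rule Suc.IH [OF holomorphic_map_on_complex_dirderiv [OF Suc.prems(1) \<open>open S\<close>] Suc.prems(2)])
  finally show ?case by (simp add: funpow_Suc_right del: funpow.simps)
qed simp

text \<open>The part of a complex line inside a convex set is convex, so the identity theorem for
  one variable applies on it.\<close>

lemma eq_0_if_dirderivs_eq_0:
  fixes F :: "'a::{complex_normed_vector,euclidean_space} \<Rightarrow> complex"
  assumes F: "F holomorphic_map_on S" "open S" "convex S" and "x \<in> S" "x + t *\<^sub>C v \<in> S"
    and "\<And>k. (complex_dirderiv v ^^ k) F x = 0"
  shows "F (x + t *\<^sub>C v) = 0"
proof (rule holomorphic_fun_eq_0_on_connected [of "\<lambda>t. F (x + t *\<^sub>C v)" "{t. x + t *\<^sub>C v \<in> S}" 0 t])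
  show "(\<lambda>t. F (x + t *\<^sub>C v)) holomorphic_on {t. x + t *\<^sub>C v \<in> S}"
    using F(1) by (rule holomorphic_on_along_line) simp
  show "(deriv ^^ k) (\<lambda>t. F (x + t *\<^sub>C v)) 0 = 0" for k
    using higher_deriv_along_line [OF F(1,2), of x 0 v k] assms by simp
qed (use assms in \<open>auto intro!: open_line_preimage convex_connected convex_line_preimage\<close>)

text \<open>Every point \<open>y\<close> of a convex set is joined to \<open>x\<close> by a complex line whose part in the set is
  connected, and one-variable continuation along it carries the vanishing near \<open>x\<close> to \<open>y\<close>.\<close>

lemma holomorphic_identity:
  fixes F :: "'a::complex_normed_vector \<Rightarrow> complex"
  assumes F: "F holomorphic_map_on S" "open S" "convex S" and x: "x \<in> S"
    and ev: "\<forall>\<^sub>F y in nhds x. F y = 0" and y: "y \<in> S"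
  shows "F y = 0"
proof -
  let ?T = "{t. x + t *\<^sub>C (y - x) \<in> S}"
  have "\<forall>\<^sub>F t in nhds 0. F (x + t *\<^sub>C (y - x)) = 0"
    using ev by (rule eventually_line)
  then obtain A where A: "open A" "0 \<in> A" "\<And>t. t \<in> A \<Longrightarrow> F (x + t *\<^sub>C (y - x)) = 0"
    unfolding eventually_nhds by blast
  have hol: "(\<lambda>t. F (x + t *\<^sub>C (y - x))) holomorphic_on ?T"
    using F(1) by (rule holomorphic_on_along_line) simp
  have "F (x + 1 *\<^sub>C (y - x)) = 0"
  proof (rule analytic_continuation_open [OF _ _ _ _ _ hol holomorphic_on_const [of 0], of "A \<inter> ?T" 1])
    show "open ?T" by (rule open_line_preimage [OF F(2)])
    with A(1) show "open (A \<inter> ?T)" by blast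
    show "connected ?T" by (intro convex_connected convex_line_preimage F(3))
    have "0 \<in> A \<inter> ?T" using A(2) x by simp
    then show "A \<inter> ?T \<noteq> {}" by blast
  qed (use A(3) y in simp_all)
  then show ?thesis by simp
qed

text \<open>Near a point where one factor is nonzero the other one vanishes, hence it vanishes everywhere by
  the identity theorem.\<close>

lemma holomorphic_mult_eq_0:
  fixes F G :: "'a::complex_normed_vector \<Rightarrow> complex"
  assumes S: "open S" "convex S" and F: "F holomorphic_map_on S" and G: "G holomorphic_map_on S"
    and prod: "\<And>x. x \<in> S \<Longrightarrow> F x * G x = 0"
  shows "(\<forall>x\<in>S. F x = 0) \<or> (\<forall>x\<in>S. G x = 0)"
proof (rule disjCI)
  assume "\<not> (\<forall>x\<in>S. G x = 0)"
  then obtain x where x: "x \<in> S" "G x \<noteq> 0" by blast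
  have "isCont G x"
    using holomorphic_map_on_imp_continuous_on [OF G] S(1) x(1) continuous_on_eq_continuous_at by blast
  then have "\<forall>\<^sub>F y in nhds x. G y \<noteq> 0"
    using x(2) by (simp add: eventually_nhds_conv_at isCont_def tendsto_imp_eventually_ne)
  moreover have "\<forall>\<^sub>F y in nhds x. y \<in> S" using S(1) x(1) by (rule eventually_nhds_in_open)
  ultimately have "\<forall>\<^sub>F y in nhds x. F y = 0"
    by eventually_elim (use prod in fastforce)
  then show "\<forall>x\<in>S. F x = 0"
    using holomorphic_identity [OF F S x(1)] by blast
qed

section \<open>Jacobian minors and annihilating vector fields\<close>

definition coord :: "('n::finite) pt \<Rightarrow> 'n option \<Rightarrow> complex" where
  "coord v k = (case k of Some j \<Rightarrow> fst v $ j | None \<Rightarrow> snd v)"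

lemma sum_option: "(\<Sum>k\<in>UNIV. f k) = f None + (\<Sum>j\<in>(UNIV :: 'n::finite set). f (Some j))"
  by (simp add: UNIV_option_conv sum.reindex)

lemma sum_coord_vec: "(\<Sum>k\<in>UNIV. c k *\<^sub>C coord_vec k) = ((\<chi> j. c (Some j)), c None)"
  by (simp add: sum_option coord_vec_def prod_eq_iff fst_sum snd_sum vec_eq_iff axis_def if_distrib
      cong: if_cong)

lemma coord_simps [simp]: "coord (z, w) None = w" "coord (z, w) (Some j) = z $ j"
  by (simp_all add: coord_def)

lemma coord_expansion: "v = (\<Sum>k\<in>UNIV. coord v k *\<^sub>C coord_vec k)"
  by (cases v) (simp add: sum_coord_vec)

lemma coord_eq_0_iff: "(\<forall>k. coord v k = 0) \<longleftrightarrow> v = 0"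
proof
  assume "\<forall>k. coord v k = 0"
  then show "v = 0" by (subst coord_expansion) simp
qed (simp add: coord_def split: option.split)

lemma coord_scaleC: "coord (c *\<^sub>C v) k = c *\<^sub>C coord v k"
  by (simp add: coord_def split: option.split)

lemma bounded_linear_coord: "bounded_linear (\<lambda>v. coord v k)"
  by (cases k) (auto simp: coord_def intro: bounded_linear_snd bounded_linear_fst
      bounded_linear_compose [OF bounded_linear_vec_nth])

lemma coord_has_complex_derivative:
  assumes "has_complex_derivative F L x"
  shows "has_complex_derivative (\<lambda>x. coord (F x) k) (\<lambda>v. coord (L v) k) x"
  by (rule has_complex_derivative_compose [OF assms])
    (intro has_complex_derivative_bounded_linear bounded_linear_coord coord_scaleC)

lemma holomorphic_map_on_coord: "F holomorphic_map_on S \<Longrightarrow> (\<lambda>x. coord (F x) k) holomorphic_map_on S"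
  by (cases k) (simp_all add: coord_def holomorphic_map_on_fst holomorphic_map_on_snd
      holomorphic_map_on_vec_nth)

lemma complex_dirderiv_coords:
  assumes "F holomorphic_map_on S" "x \<in> S"
  shows "complex_dirderiv v F x = (\<Sum>k\<in>UNIV. coord v k * complex_dirderiv (coord_vec k) F x)"
  by (subst (1) coord_expansion)
    (simp add: complex_dirderiv_linear(4) [OF assms] complex_dirderiv_linear(2) [OF assms])

definition gradient :: "(('n::finite) pt \<Rightarrow> complex) \<Rightarrow> 'n pt \<Rightarrow> complex ^ ('n option)" where
  "gradient F x = (\<chi> k. complex_dirderiv (coord_vec k) F x)"

text \<open>Completing the rows outside \<open>C\<close> by unit vectors turns every minor into a determinant of full
  size, which gives access to row operations on matrices.\<close>

lemma jacobian_minor_eq_det: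
  "jacobian_minor \<phi> C \<rho> x = det (\<chi> i. if i \<in> C then gradient (\<phi> (\<rho> i)) x else axis i 1)"
proof -
  let ?A = "\<chi> i. if i \<in> C then gradient (\<phi> (\<rho> i)) x else axis i 1"
  have "det ?A = (\<Sum>\<pi> | \<pi> permutes UNIV. of_int (sign \<pi>) * (\<Prod>i\<in>UNIV. ?A $ i $ \<pi> i))"
    by (simp add: det_def)
  also have "\<dots> = (\<Sum>\<pi> | \<pi> permutes C. of_int (sign \<pi>) * (\<Prod>i\<in>UNIV. ?A $ i $ \<pi> i))"
  proof (rule sum.mono_neutral_right)
    show "{\<pi>. \<pi> permutes C} \<subseteq> {\<pi>. \<pi> permutes UNIV}"
      using permutes_subset by blast
    show "\<forall>\<pi>\<in>{\<pi>. \<pi> permutes UNIV} - {\<pi>. \<pi> permutes C}. of_int (sign \<pi>) * (\<Prod>i\<in>UNIV. ?A $ i $ \<pi> i) = 0"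
    proof
      fix \<pi> assume \<pi>: "\<pi> \<in> {\<pi>. \<pi> permutes UNIV} - {\<pi>. \<pi> permutes C}"
      then obtain i where "i \<notin> C" "\<pi> i \<noteq> i"
        by (auto simp: permutes_def)
      then have "?A $ i $ \<pi> i = 0" by (simp add: axis_def)
      then have "(\<Prod>i\<in>UNIV. ?A $ i $ \<pi> i) = 0"
        by (rule prod_zero [OF finite bexI [OF _ UNIV_I]])
      then show "of_int (sign \<pi>) * (\<Prod>i\<in>UNIV. ?A $ i $ \<pi> i) = 0" by simp
    qed
  qed (simp add: finite_permutations)
  also have "\<dots> = jacobian_minor \<phi> C \<rho> x"
    unfolding jacobian_minor_def
  proof (intro sum.cong refl arg_cong2 [where f = "(*)"])
    fix \<pi> assume "\<pi> \<in> {\<pi>. \<pi> permutes C}"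
    then have "(\<Prod>i\<in>UNIV. ?A $ i $ \<pi> i) = (\<Prod>i\<in>C. ?A $ i $ \<pi> i)"
      by (intro prod.mono_neutral_right) (auto simp: axis_def permutes_def)
    then show "(\<Prod>i\<in>UNIV. ?A $ i $ \<pi> i) = (\<Prod>k\<in>C. complex_dirderiv (coord_vec (\<pi> k)) (\<phi> (\<rho> k)) x)"
      by (simp add: gradient_def)
  qed
  finally show ?thesis ..
qed

lemma jacobian_minor_UNIV:
  "jacobian_minor \<phi> UNIV \<rho> x = det (\<chi> i. gradient (\<phi> (\<rho> i)) x)"
  by (simp add: jacobian_minor_eq_det)

lemma holomorphic_map_on_det:
  fixes A :: "_ \<Rightarrow> complex ^ 'm ^ 'm"
  assumes "\<And>i j. (\<lambda>x. A x $ i $ j) holomorphic_map_on S"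
  shows "(\<lambda>x. det (A x)) holomorphic_map_on S"
  unfolding det_def
  by (intro holomorphic_map_on_sum holomorphic_map_on_mult holomorphic_map_on_const
      holomorphic_map_on_prod assms)

lemma holomorphic_map_on_gradient:
  assumes "F holomorphic_map_on S" "open S"
  shows "(\<lambda>x. gradient F x $ k) holomorphic_map_on S"
  using holomorphic_map_on_complex_dirderiv [OF assms, of "coord_vec k"] by (simp add: gradient_def)

lemma holomorphic_map_on_jacobian_minor:
  assumes "\<And>i. i \<in> C \<Longrightarrow> \<phi> (\<rho> i) holomorphic_map_on S" "open S"
  shows "jacobian_minor \<phi> C \<rho> holomorphic_map_on S"
proof -
  have "(\<lambda>x. (\<chi> i. if i \<in> C then gradient (\<phi> (\<rho> i)) x else axis i 1) $ i $ j) holomorphic_map_on S" for i j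
    using holomorphic_map_on_gradient [OF assms(1) assms(2)]
    by (cases "i \<in> C") (simp_all add: holomorphic_map_on_const)
  then show ?thesis
    unfolding jacobian_minor_eq_det [abs_def] by (rule holomorphic_map_on_det)
qed

text \<open>Cofactor expansion, with the cofactors written as determinants in which a unit vector replaces the
  row; in this form they are visibly holomorphic and do not depend on \<open>r\<close>.\<close>

lemma det_row_expansion:
  "det (\<chi> i. if i = k then r else c i) = (\<Sum>j\<in>UNIV. r $ j * det (\<chi> i. if i = k then axis j 1 else c i))"
  for r :: "'a::field ^ 'm::finite"
proof -
  have "det (\<chi> i. if i = k then r else c i) =
      det (\<chi> i. if i = k then (\<Sum>j\<in>UNIV. r $ j *s axis j 1) else c i)"
    by (simp only: basis_expansion)
  also have "\<dots> = (\<Sum>j\<in>UNIV. det (\<chi> i. if i = k then r $ j *s axis j 1 else c i))"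
    using det_linear_row_sum [of UNIV k "\<lambda>i j. r $ j *s axis j 1" c] by simp
  also have "\<dots> = (\<Sum>j\<in>UNIV. r $ j * det (\<chi> i. if i = k then axis j 1 else c i))"
    using det_row_mul [of k "r $ j" "\<lambda>i. axis j 1" c for j] by simp
  finally show ?thesis .
qed

text \<open>Take a minor of maximal size that is not identically zero, add one column to it, and let the
  components of the field be the cofactors of one further row. Applied to a member of the family,
  the field gives the minor extended by the gradient of this member, which vanishes by maximality
  or because two rows agree. The component belonging to the new column is the chosen minor, so the
  field is nontrivial.\<close>

lemma annihilating_field_exists:
  fixes \<phi> :: "'i \<Rightarrow> ('n::finite) pt \<Rightarrow> complex"
  assumes U: "open U" "U \<noteq> {}"
    and \<phi>: "\<And>i. i \<in> I \<Longrightarrow> \<phi> i holomorphic_map_on U"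
    and minors: "\<And>\<rho> x. inj \<rho> \<Longrightarrow> range \<rho> \<subseteq> I \<Longrightarrow> x \<in> U \<Longrightarrow> jacobian_minor \<phi> UNIV \<rho> x = 0"
  obtains a where "a holomorphic_map_on U" "\<exists>x\<in>U. a x \<noteq> 0"
    "\<And>i x. i \<in> I \<Longrightarrow> x \<in> U \<Longrightarrow> complex_dirderiv (a x) (\<phi> i) x = 0"
proof -
  define P where "P = (\<lambda>(C, \<rho>). inj_on \<rho> C \<and> \<rho> ` C \<subseteq> I \<and> (\<exists>x\<in>U. jacobian_minor \<phi> C \<rho> x \<noteq> 0))"
  have "P ({}, undefined)"
    using U(2) by (auto simp: P_def jacobian_minor_def)
  moreover have "card (fst p) \<le> CARD('n option)" for p :: "'n option set \<times> ('n option \<Rightarrow> 'i)"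
    by (rule card_mono) auto
  ultimately have "\<exists>p. P p \<and> (\<forall>p'. P p' \<longrightarrow> card (fst p') \<le> card (fst p))"
    by (intro ex_has_greatest_nat [of P _ "\<lambda>p. card (fst p)" "Suc CARD('n option)"]) (auto simp: le_imp_less_Suc)
  then obtain C \<rho> where C: "P (C, \<rho>)" and max: "\<And>C' \<rho>'. P (C', \<rho>') \<Longrightarrow> card C' \<le> card C"
    by fastforce
  obtain x0 where \<rho>: "inj_on \<rho> C" "\<rho> ` C \<subseteq> I" and x0: "x0 \<in> U" "jacobian_minor \<phi> C \<rho> x0 \<noteq> 0"
    using C unfolding P_def by auto
  have "C \<noteq> UNIV"
    using minors [OF _ _ x0(1), of \<rho>] \<rho> x0(2) by auto
  then obtain k where k: "k \<notin> C" by blast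
  \<comment> \<open>the maximal minor, extended by the row \<open>r\<close> in place \<open>k\<close> and by unit vectors elsewhere\<close>
  define A where "A = (\<lambda>r x. \<chi> i. if i = k then r else if i \<in> C then gradient (\<phi> (\<rho> i)) x else axis i 1)"
  define a where "a = (\<lambda>x. \<Sum>j\<in>UNIV. det (A (axis j 1) x) *\<^sub>C coord_vec j)"
  show thesis
  proof (rule that)
    have "(\<lambda>x. A (axis j 1) x $ i $ l) holomorphic_map_on U" for i j l
      using holomorphic_map_on_gradient [OF \<phi> U(1), of "\<rho> i" l] \<rho>(2) k
      by (cases "i = k"; cases "i \<in> C") (auto simp: A_def holomorphic_map_on_const)
    then show "a holomorphic_map_on U"
      unfolding a_def
      by (intro holomorphic_map_on_sum holomorphic_map_on_scaleC holomorphic_map_on_const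
          holomorphic_map_on_det)
    have "coord (a x0) k = det (A (axis k 1) x0)"
      unfolding a_def sum_coord_vec by (cases k) simp_all
    also have "A (axis k 1) x0 = (\<chi> i. if i \<in> C then gradient (\<phi> (\<rho> i)) x0 else axis i 1)"
      using k by (auto simp: A_def vec_eq_iff)
    finally have "coord (a x0) k \<noteq> 0"
      using x0(2) unfolding jacobian_minor_eq_det by simp
    then show "\<exists>x\<in>U. a x \<noteq> 0"
      using x0(1) coord_eq_0_iff by blast
    fix i x assume i: "i \<in> I" and x: "x \<in> U"
    have "complex_dirderiv (a x) (\<phi> i) x =
        (\<Sum>j\<in>UNIV. gradient (\<phi> i) x $ j * det (A (axis j 1) x))"
      unfolding a_def complex_dirderiv_linear(4) [OF \<phi> [OF i] x]
      by (simp add: complex_dirderiv_linear(2) [OF \<phi> [OF i] x] gradient_def mult.commute)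
    also have "\<dots> = det (A (gradient (\<phi> i) x) x)"
      unfolding A_def by (rule det_row_expansion [symmetric])
    also have "\<dots> = 0"
    proof (cases "i \<in> \<rho> ` C")
      case True
      then obtain c where "c \<in> C" "i = \<rho> c" by blast
      then show ?thesis
        using k by (intro det_identical_rows [of c k]) (auto simp: row_def A_def vec_eq_iff)
    next
      case False
      let ?\<rho> = "\<rho>(k := i)"
      have "\<not> P (insert k C, ?\<rho>)"
        using max [of "insert k C" ?\<rho>] k by auto
      moreover have "inj_on ?\<rho> (insert k C)"
        using \<rho>(1) False k by (auto simp: inj_on_def)
      moreover have "?\<rho> ` insert k C \<subseteq> I"
        using \<rho>(2) i k by auto
      ultimately have "jacobian_minor \<phi> (insert k C) ?\<rho> x = 0"
        using x unfolding P_def by blast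
      moreover have "A (gradient (\<phi> i) x) x =
          (\<chi> j. if j \<in> insert k C then gradient (\<phi> (?\<rho> j)) x else axis j 1)"
        using k by (auto simp: A_def vec_eq_iff)
      ultimately show ?thesis by (simp only: jacobian_minor_eq_det)
    qed
    finally show "complex_dirderiv (a x) (\<phi> i) x = 0" .
  qed
qed

lemma matrix_kernel_trivial:
  fixes A :: "complex ^ 'm ^ 'm"
  assumes "A *v u = 0"
  shows "det A = 0 \<or> u = 0"
proof (rule disjCI)
  assume "u \<noteq> 0"
  with assms have "\<nexists>B. B ** A = mat 1"
    using matrix_left_invertible_ker by blast
  then show "det A = 0"
    using invertible_det_nz invertible_left_inverse by blast
qed

lemma annihilated_imp_zero:
  fixes u :: "('n::finite) pt"
  assumes "\<And>i. \<phi> (\<rho> i) holomorphic_map_on U" "x \<in> U"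
    and "\<And>i. complex_dirderiv u (\<phi> (\<rho> i)) x = 0"
  shows "jacobian_minor \<phi> UNIV \<rho> x = 0 \<or> u = 0"
proof -
  have "(\<Sum>k\<in>UNIV. coord u k * complex_dirderiv (coord_vec k) (\<phi> (\<rho> i)) x) = 0" for i
    using complex_dirderiv_coords [OF assms(1,2), of u i] assms(3) by metis
  then have "(\<chi> i. gradient (\<phi> (\<rho> i)) x) *v (\<chi> k. coord u k) = 0"
    by (simp add: vec_eq_iff matrix_vector_mult_def gradient_def mult.commute)
  then have "jacobian_minor \<phi> UNIV \<rho> x = 0 \<or> (\<chi> k. coord u k) = 0"
    unfolding jacobian_minor_UNIV by (rule matrix_kernel_trivial)
  then show ?thesis
    by (auto simp: vec_eq_iff coord_eq_0_iff [symmetric])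
qed

text \<open>The vector \<open>a x\<close> is in the kernel of the matrix of gradients, whose determinant is a nonzero germ.
  Thus the product of this determinant with each component of \<open>a\<close> vanishes, and so does the component.\<close>

lemma annihilating_field_trivial:
  fixes a :: "('n::finite) pt \<Rightarrow> 'n pt"
  assumes U: "open U" "convex U" "0 \<in> U" and \<phi>: "\<And>i. \<phi> (\<rho> i) holomorphic_map_on U"
    and a: "a holomorphic_map_on U"
    and ann: "\<And>i x. x \<in> U \<Longrightarrow> complex_dirderiv (a x) (\<phi> (\<rho> i)) x = 0"
    and minor: "\<not> (\<forall>\<^sub>F x in nhds 0. jacobian_minor \<phi> UNIV \<rho> x = 0)" and x: "x \<in> U"
  shows "a x = 0"
proof -
  have "\<not> (\<forall>x\<in>U. jacobian_minor \<phi> UNIV \<rho> x = 0)"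
    using minor U unfolding eventually_nhds by blast
  moreover have "(\<forall>x\<in>U. jacobian_minor \<phi> UNIV \<rho> x = 0) \<or> (\<forall>x\<in>U. coord (a x) k = 0)" for k
  proof (rule holomorphic_mult_eq_0 [OF U(1,2)])
    show "jacobian_minor \<phi> UNIV \<rho> holomorphic_map_on U"
      using \<phi> U(1) by (intro holomorphic_map_on_jacobian_minor)
    show "(\<lambda>x. coord (a x) k) holomorphic_map_on U"
      using a by (rule holomorphic_map_on_coord)
    show "jacobian_minor \<phi> UNIV \<rho> x * coord (a x) k = 0" if "x \<in> U" for x
      using annihilated_imp_zero [where \<phi> = \<phi> and \<rho> = \<rho>, OF \<phi> that ann [OF that]] coord_eq_0_iff [of "a x"] by auto
  qed
  ultimately show ?thesis using x coord_eq_0_iff by blast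
qed

definition jacobian_det :: "(('n::finite) pt \<Rightarrow> 'n pt) \<Rightarrow> 'n pt \<Rightarrow> complex" where
  "jacobian_det F = jacobian_minor (\<lambda>k x. coord (F x) k) UNIV id"

lemma jacobian_minor_coord_permuted:
  assumes "inj \<rho>"
  shows "jacobian_minor (\<lambda>k x. coord (F x) k) UNIV \<rho> x = of_int (sign \<rho>) * jacobian_det F x"
proof -
  have "\<rho> permutes UNIV"
    using assms by (intro bij_imp_permutes) (auto simp: bij_def finite_UNIV_inj_surj)
  from det_permute_rows [OF this, of "\<chi> i. gradient (\<lambda>x. coord (F x) i) x"]
  show ?thesis by (simp add: jacobian_det_def jacobian_minor_UNIV)
qed

text \<open>By the chain rule the matrix of gradients of the composed family is a matrix product.\<close>

lemma jacobian_minor_compose: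
  assumes F: "F holomorphic_map_on S" "x \<in> S"
    and \<phi>: "\<And>i. \<phi> (\<rho> i) holomorphic_map_on T" "F x \<in> T"
  shows "jacobian_minor (\<lambda>i x. \<phi> i (F x)) UNIV \<rho> x =
    jacobian_minor \<phi> UNIV \<rho> (F x) * jacobian_det F x"
proof -
  obtain L where L: "has_complex_derivative F L x"
    using F unfolding holomorphic_map_on_iff by blast
  have Lk: "coord (L v) k = complex_dirderiv v (\<lambda>x. coord (F x) k) x" for v k
    by (rule complex_dirderiv_eq [OF coord_has_complex_derivative [OF L], symmetric])
  have "gradient (\<lambda>x. \<phi> (\<rho> i) (F x)) x $ k =
    ((\<chi> i. gradient (\<phi> (\<rho> i)) (F x)) ** (\<chi> i. gradient (\<lambda>x. coord (F x) i) x)) $ i $ k" for i k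
    by (simp add: gradient_def matrix_matrix_mult_def complex_dirderiv_compose [OF L \<phi>]
        complex_dirderiv_coords [OF \<phi>, of "L _"] Lk mult.commute)
  then have "(\<chi> i. gradient (\<lambda>x. \<phi> (\<rho> i) (F x)) x) =
      (\<chi> i. gradient (\<phi> (\<rho> i)) (F x)) ** (\<chi> i. gradient (\<lambda>x. coord (F x) i) x)"
    by (simp add: vec_eq_iff)
  then show ?thesis
    by (simp add: jacobian_det_def jacobian_minor_UNIV det_mul)
qed

text \<open>The maximum in the definition of the generic rank exists, since the empty minor is \<open>1\<close> and no
  minor has more than \<open>n + 1\<close> columns.\<close>

lemma generic_rank_full_iff:
  fixes \<phi> :: "'i \<Rightarrow> ('n::finite) pt \<Rightarrow> complex"
  shows "generic_rank I \<phi> = CARD('n) + 1 \<longleftrightarrow>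
    (\<exists>\<rho>. inj \<rho> \<and> range \<rho> \<subseteq> I \<and> \<not> (\<forall>\<^sub>F Z in nhds 0. jacobian_minor \<phi> UNIV \<rho> Z = 0))"
proof -
  define P where "P = (\<lambda>r. \<exists>C \<rho>. card C = r \<and> inj_on \<rho> C \<and> \<rho> ` C \<subseteq> I \<and>
        \<not> (\<forall>\<^sub>F Z in nhds 0. jacobian_minor \<phi> C \<rho> Z = 0))"
  have card: "CARD('n option) = CARD('n) + 1" by (simp add: card_UNIV_option)
  have P0: "P 0"
    unfolding P_def by (rule exI [of _ "{}"]) (auto simp: jacobian_minor_def)
  have bound: "r \<le> CARD('n) + 1" if "P r" for r
    using that card_mono [OF finite subset_UNIV] unfolding P_def card [symmetric] by blast
  have "generic_rank I \<phi> = (GREATEST r. P r)" by (simp add: generic_rank_def P_def)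
  also have "(GREATEST r. P r) = CARD('n) + 1 \<longleftrightarrow> P (CARD('n) + 1)"
    using GreatestI_nat [of P 0, OF P0 bound] bound by (metis Greatest_equality)
  also have "\<dots> \<longleftrightarrow> (\<exists>\<rho>. inj \<rho> \<and> range \<rho> \<subseteq> I \<and>
      \<not> (\<forall>\<^sub>F Z in nhds 0. jacobian_minor \<phi> UNIV \<rho> Z = 0))"
  proof -
    have "card C = CARD('n) + 1 \<longleftrightarrow> C = UNIV" for C :: "'n option set"
      unfolding card [symmetric] using card_subset_eq [of UNIV C] by auto
    then show ?thesis unfolding P_def by auto
  qed
  finally show ?thesis .
qed

lemma injective_if_jacobian_det_nonzero:
  fixes F :: "('n::finite) pt \<Rightarrow> 'n pt"
  assumes F: "F holomorphic_map_on U" "x \<in> U" and L: "has_complex_derivative F L x"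
    and det: "jacobian_det F x \<noteq> 0" and u: "L u = 0"
  shows "u = 0"
proof -
  have "complex_dirderiv u (\<lambda>x. coord (F x) k) x = 0" for k
    using complex_dirderiv_eq [OF coord_has_complex_derivative [OF L]] u coord_eq_0_iff by metis
  then have "jacobian_minor (\<lambda>k x. coord (F x) k) UNIV id x = 0 \<or> u = 0"
    by (intro annihilated_imp_zero [where U = U and \<rho> = id] holomorphic_map_on_coord F) auto
  with det show ?thesis by (simp add: jacobian_det_def)
qed

section \<open>Germs at the origin\<close>

definition holomorphic_germ :: "('a::complex_normed_vector \<Rightarrow> 'b::complex_normed_vector) \<Rightarrow> bool" where
  "holomorphic_germ F \<longleftrightarrow> (\<exists>S. open S \<and> 0 \<in> S \<and> F holomorphic_map_on S)"

lemma tendsto_holomorphic_germ: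
  assumes "holomorphic_germ F" shows "(F \<longlongrightarrow> F 0) (nhds 0)"
proof -
  obtain S where S: "open S" "0 \<in> S" "F holomorphic_map_on S"
    using assms unfolding holomorphic_germ_def by blast
  then have "isCont F 0"
    using holomorphic_map_on_imp_continuous_on continuous_on_eq_continuous_at by blast
  then show ?thesis by (simp add: isCont_def tendsto_at_iff_tendsto_nhds)
qed

lemma eventually_holomorphic_germ:
  assumes "holomorphic_germ F" "F 0 = 0" "\<forall>\<^sub>F y in nhds 0. P y"
  shows "\<forall>\<^sub>F x in nhds 0. P (F x)"
  using eventually_compose_filterlim [OF assms(3)] tendsto_holomorphic_germ [OF assms(1)] assms(2)
  by simp

lemma eventually_continuous_0:
  fixes F :: "'a::real_normed_vector \<Rightarrow> 'b::real_normed_vector"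
  assumes "continuous_on UNIV F" "F 0 = 0" "\<forall>\<^sub>F y in nhds 0. P y"
  shows "\<forall>\<^sub>F x in nhds 0. P (F x)"
proof -
  have "isCont F 0" using assms(1) by (simp add: continuous_on_eq_continuous_at)
  then have "(F \<longlongrightarrow> F 0) (nhds 0)" by (simp add: isCont_def tendsto_at_iff_tendsto_nhds)
  with eventually_compose_filterlim [OF assms(3)] assms(2) show ?thesis by simp
qed

lemma holomorphic_germI: "open S \<Longrightarrow> 0 \<in> S \<Longrightarrow> F holomorphic_map_on S \<Longrightarrow> holomorphic_germ F"
  unfolding holomorphic_germ_def by blast

lemma holomorphic_germ_ball:
  assumes "holomorphic_germ F"
  obtains r where "0 < r" "F holomorphic_map_on ball 0 r"
  using assms open_contains_ball holomorphic_map_on_subset unfolding holomorphic_germ_def by metis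

lemma holomorphic_germ_compose:
  assumes F: "holomorphic_germ F" "F 0 = 0" and G: "holomorphic_germ G"
  shows "holomorphic_germ (\<lambda>x. G (F x))"
proof -
  obtain S where S: "open S" "0 \<in> S" "F holomorphic_map_on S"
    using F unfolding holomorphic_germ_def by blast
  obtain T where T: "open T" "0 \<in> T" "G holomorphic_map_on T"
    using G unfolding holomorphic_germ_def by blast
  show ?thesis
  proof (rule holomorphic_germI [of "S \<inter> F -` T"])
    show "open (S \<inter> F -` T)"
      by (rule continuous_open_preimage) (use S T holomorphic_map_on_imp_continuous_on in auto)
    show "(\<lambda>x. G (F x)) holomorphic_map_on S \<inter> F -` T"
      by (rule holomorphic_map_on_compose [OF _ T(3)]) (use holomorphic_map_on_subset [OF S(3)] in auto)
  qed (use S T F in auto)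
qed

lemma holomorphic_germ_Pair:
  assumes "holomorphic_germ F" "holomorphic_germ G"
  shows "holomorphic_germ (\<lambda>x. (F x, G x))"
proof -
  obtain S T where ST: "open S" "0 \<in> S" "F holomorphic_map_on S" "open T" "0 \<in> T" "G holomorphic_map_on T"
    using assms unfolding holomorphic_germ_def by blast
  show ?thesis
    by (rule holomorphic_germI [of "S \<inter> T"])
      (use ST in \<open>auto intro!: holomorphic_map_on_Pair intro: holomorphic_map_on_subset\<close>)
qed

lemma holomorphic_germ_ident: "holomorphic_germ (\<lambda>x. x)"
  by (rule holomorphic_germI [OF open_UNIV]) (auto intro: holomorphic_map_on_ident)

lemma holomorphic_germ_const: "holomorphic_germ (\<lambda>x. c)"
  by (rule holomorphic_germI [OF open_UNIV]) (auto intro: holomorphic_map_on_const)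

lemma holomorphic_germ_fst: "holomorphic_germ F \<Longrightarrow> holomorphic_germ (\<lambda>x. fst (F x))"
  unfolding holomorphic_germ_def by (blast intro: holomorphic_map_on_fst)

lemma holomorphic_germ_snd: "holomorphic_germ F \<Longrightarrow> holomorphic_germ (\<lambda>x. snd (F x))"
  unfolding holomorphic_germ_def by (blast intro: holomorphic_map_on_snd)

lemmas holomorphic_germ_intros = holomorphic_germ_Pair holomorphic_germ_ident holomorphic_germ_const
  holomorphic_germ_fst holomorphic_germ_snd

lemma holomorphic_germ_diff:
  fixes F G :: "'a::complex_normed_vector \<Rightarrow> complex"
  assumes "holomorphic_germ F" "holomorphic_germ G"
  shows "holomorphic_germ (\<lambda>x. F x - G x)"
proof -
  obtain S T where ST: "open S" "0 \<in> S" "F holomorphic_map_on S" "open T" "0 \<in> T" "G holomorphic_map_on T"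
    using assms unfolding holomorphic_germ_def by blast
  show ?thesis
    by (rule holomorphic_germI [of "S \<inter> T"])
      (use ST in \<open>auto intro!: holomorphic_map_on_diff intro: holomorphic_map_on_subset\<close>)
qed

lemma eventually_has_complex_derivative:
  assumes "holomorphic_germ F"
  shows "\<forall>\<^sub>F x in nhds 0. \<exists>L. has_complex_derivative F L x"
  using assms unfolding holomorphic_germ_def holomorphic_map_on_iff eventually_nhds by blast

lemma open_contains_ball_product:
  fixes W :: "('a::real_normed_vector \<times> 'b::real_normed_vector) set"
  assumes "open W" "0 \<in> W"
  obtains r where "0 < r" "ball 0 r \<times> ball 0 r \<subseteq> W"
proof -
  obtain e where e: "0 < e" "ball 0 e \<subseteq> W" using assms open_contains_ball by blast
  have "ball (0::'a) (e/2) \<times> ball (0::'b) (e/2) \<subseteq> ball 0 e"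
  proof
    fix p :: "'a \<times> 'b" assume "p \<in> ball 0 (e/2) \<times> ball 0 (e/2)"
    then have "norm (fst p) + norm (snd p) < e" by (auto simp: mem_Times_iff)
    then show "p \<in> ball 0 e" using norm_Pair_le [of "fst p" "snd p"] by simp
  qed
  then show thesis using that [of "e/2"] e by auto
qed

lemma eventually_nhds_0_prod_iff:
  fixes P :: "'a::real_normed_vector \<times> 'b::real_normed_vector \<Rightarrow> bool"
  shows "(\<forall>\<^sub>F p in nhds 0. P p) \<longleftrightarrow> (\<exists>r>0. \<forall>x\<in>ball 0 r. \<forall>y\<in>ball 0 r. P (x, y))"
proof
  assume "\<forall>\<^sub>F p in nhds 0. P p"
  then obtain W where "open W" "0 \<in> W" "\<forall>p\<in>W. P p" unfolding eventually_nhds by blast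
  then show "\<exists>r>0. \<forall>x\<in>ball 0 r. \<forall>y\<in>ball 0 r. P (x, y)"
    using open_contains_ball_product [of W] by (metis SigmaI subsetD)
next
  assume "\<exists>r>0. \<forall>x\<in>ball 0 r. \<forall>y\<in>ball 0 r. P (x, y)"
  then obtain r where r: "0 < r" "\<forall>x\<in>ball 0 r. \<forall>y\<in>ball 0 r. P (x, y)" by blast
  have "open (ball 0 r \<times> ball 0 r)" "0 \<in> ball (0::'a) r \<times> ball (0::'b) r"
    using r(1) by (auto intro: open_Times simp: zero_prod_def)
  then show "\<forall>\<^sub>F p in nhds 0. P p" unfolding eventually_nhds
    using r(2) by (intro exI [of _ "ball 0 r \<times> ball 0 r"]) auto
qed

lemma eventually_nhds_0_fst:
  fixes P :: "'a::real_normed_vector \<Rightarrow> bool"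
  assumes "\<forall>\<^sub>F x in nhds 0. P x"
  shows "\<forall>\<^sub>F p :: 'a \<times> 'b::real_normed_vector in nhds 0. P (fst p)"
  using eventually_continuous_0 [of fst, OF _ _ assms] by (simp add: continuous_on_fst)

lemma eventually_nhds_0_snd:
  fixes P :: "'b::real_normed_vector \<Rightarrow> bool"
  assumes "\<forall>\<^sub>F y in nhds 0. P y"
  shows "\<forall>\<^sub>F p :: 'a::real_normed_vector \<times> 'b in nhds 0. P (snd p)"
  using eventually_continuous_0 [of snd, OF _ _ assms] by (simp add: continuous_on_snd)

lemma ball_product:
  assumes "0 < r"
  shows "open (ball (0::'a::real_normed_vector) r \<times> ball (0::'b::real_normed_vector) r)"
    and "convex (ball (0::'a) r \<times> ball (0::'b) r)" and "0 \<in> ball (0::'a) r \<times> ball (0::'b) r"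
  using assms by (auto intro: open_Times convex_Times simp: zero_prod_def)

section \<open>Derivatives in the first group of variables\<close>

abbreviation z_derivs :: "('n::finite) list \<Rightarrow> ('n Qdom \<Rightarrow> complex) \<Rightarrow> 'n Qdom \<Rightarrow> complex" where
  "z_derivs js F \<equiv> foldr (\<lambda>j. complex_dirderiv (axis j 1, 0, 0)) js F"

lemma holomorphic_map_on_z_derivs:
  assumes "F holomorphic_map_on U" "open U"
  shows "z_derivs js F holomorphic_map_on U"
  using assms by (induction js) (auto intro: holomorphic_map_on_complex_dirderiv)

lemma complex_dirderiv_z_derivs_commute:
  assumes F: "F holomorphic_map_on U" "open U" "x \<in> U"
  shows "complex_dirderiv v (z_derivs js F) x = z_derivs js (complex_dirderiv v F) x"
  using F(3)
proof (induction js arbitrary: x)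
  case (Cons j js)
  have "complex_dirderiv v (z_derivs (j # js) F) x =
      complex_dirderiv (axis j 1, 0, 0) (complex_dirderiv v (z_derivs js F)) x"
    using complex_dirderiv_commute [OF holomorphic_map_on_z_derivs [OF F(1,2)] F(2) Cons.prems] by simp
  also have "\<dots> = complex_dirderiv (axis j 1, 0, 0) (z_derivs js (complex_dirderiv v F)) x"
    by (rule complex_dirderiv_cong_open [OF F(2) Cons.prems Cons.IH])
  finally show ?case by simp
qed simp

lemma z_derivs_reorder:
  assumes F: "F holomorphic_map_on U" "open U" and "mset js = mset js'" "x \<in> U"
  shows "z_derivs js F x = z_derivs js' F x"
  using assms(3,4)
proof (induction js arbitrary: js' x)
  case (Cons j ks)
  have "j \<in> set js'" using Cons.prems(1) by (metis list.set_intros(1) mset_eq_setD)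
  then obtain ys zs where js': "js' = ys @ j # zs" by (meson split_list)
  then have ks: "mset ks = mset (ys @ zs)" using Cons.prems(1) by simp
  have "z_derivs (j # ks) F x = complex_dirderiv (axis j 1, 0, 0) (z_derivs (ys @ zs) F) x"
    using complex_dirderiv_cong_open [OF F(2) Cons.prems(2) Cons.IH [OF ks]] by simp
  also have "\<dots> = z_derivs js' F x"
    using complex_dirderiv_z_derivs_commute
      [OF holomorphic_map_on_z_derivs [OF F] F(2) Cons.prems(2)] by (simp add: js')
  finally show ?case .
qed simp

text \<open>Partial derivatives commute, so the choice of the order of differentiation in \<open>z_deriv\<close> is
  irrelevant where the function is holomorphic.\<close>

lemma z_deriv_count_list:
  assumes "F holomorphic_map_on U" "open U" "x \<in> U"
  shows "z_deriv (count_list js) F x = z_derivs js F x"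
proof -
  let ?js = "SOME js'. \<forall>j. count_list js' j = count_list js j"
  have "\<forall>j. count_list ?js j = count_list js j"
    by (rule someI [of "\<lambda>js'. \<forall>j. count_list js' j = count_list js j" js]) simp
  then have "mset ?js = mset js" by (simp add: multiset_eq_iff count_mset)
  then show ?thesis unfolding z_deriv_def by (rule z_derivs_reorder [OF assms(1,2) _ assms(3)])
qed

lemma z_deriv_eq_z_derivs: obtains js where "\<And>F. z_deriv \<alpha> F = z_derivs js F"
  unfolding z_deriv_def by blast

text \<open>The iterated derivatives in the direction \<open>(z, 0)\<close> are linear combinations of iterated partial
  derivatives, so all of them vanish at \<open>(0, \<zeta>)\<close>, and the complex line through \<open>(0, \<zeta>)\<close> and \<open>(z, \<zeta>)\<close>
  reduces the claim to one variable.\<close>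

lemma eq_0_if_z_derivs_eq_0:
  fixes F :: "('n::finite) Qdom \<Rightarrow> complex"
  assumes F: "F holomorphic_map_on U" and U: "open U" "convex U" "(0, \<zeta>) \<in> U" "(z, \<zeta>) \<in> U"
    and van: "\<And>js. z_derivs js F (0, \<zeta>) = 0"
  shows "F (z, \<zeta>) = 0"
proof -
  let ?v = "(z, 0) :: 'n Qdom"
  have v: "?v = (\<Sum>j\<in>UNIV. (z $ j) *\<^sub>C (axis j 1, 0, 0))"
    by (simp add: prod_eq_iff fst_sum snd_sum vec_eq_iff axis_def if_distrib cong: if_cong)
  have expand: "complex_dirderiv ?v G (0, \<zeta>) =
      (\<Sum>j\<in>UNIV. z $ j * complex_dirderiv (axis j 1, 0, 0) G (0, \<zeta>))"
    if "G holomorphic_map_on U" for G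
    unfolding v by (simp only: complex_dirderiv_linear(2,4) [OF that U(3)])
  have D: "(complex_dirderiv ?v ^^ k) F holomorphic_map_on U \<and>
      (\<forall>js. z_derivs js ((complex_dirderiv ?v ^^ k) F) (0, \<zeta>) = 0)" for k
  proof (induction k)
    case (Suc k)
    let ?G = "(complex_dirderiv ?v ^^ k) F"
    have G: "?G holomorphic_map_on U" using Suc by blast
    have "z_derivs js (complex_dirderiv ?v ?G) (0, \<zeta>) = 0" for js
    proof -
      have "z_derivs js (complex_dirderiv ?v ?G) (0, \<zeta>) = complex_dirderiv ?v (z_derivs js ?G) (0, \<zeta>)"
        by (rule complex_dirderiv_z_derivs_commute [OF G U(1,3), symmetric])
      also have "\<dots> = (\<Sum>j\<in>UNIV. z $ j * z_derivs (j # js) ?G (0, \<zeta>))"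
        by (simp add: expand [OF holomorphic_map_on_z_derivs [OF G U(1)]])
      also have "\<dots> = 0"
        by (intro sum.neutral ballI) (simp only: conjunct2 [OF Suc, rule_format] mult_zero_right)
      finally show ?thesis .
    qed
    then show ?case using holomorphic_map_on_complex_dirderiv [OF G U(1)] by simp
  qed (use F van in auto)
  have "(complex_dirderiv ?v ^^ k) F (0, \<zeta>) = 0" for k
    using D [of k] by (metis foldr.simps(1) id_apply)
  then have "F ((0, \<zeta>) + 1 *\<^sub>C ?v) = 0"
    by (intro eq_0_if_dirderivs_eq_0 [OF F U(1-3)]) (use U(4) in auto)
  then show ?thesis by simp
qed

lemma complex_dirderiv_eq_0_on_line:
  assumes "open U" "x \<in> U" "\<And>t. x + t *\<^sub>C v \<in> U \<Longrightarrow> F (x + t *\<^sub>C v) = 0"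
  shows "complex_dirderiv v F x = 0"
proof -
  have "\<forall>\<^sub>F y in nhds x. y \<in> U" using assms(1,2) by (rule eventually_nhds_in_open)
  from eventually_line [OF this, of v]
  have "\<forall>\<^sub>F t in nhds 0. F (x + t *\<^sub>C v) = 0"
    by (rule eventually_mono) (rule assms(3))
  then have "deriv (\<lambda>t. F (x + t *\<^sub>C v)) 0 = deriv (\<lambda>t. 0) 0"
    by (intro deriv_cong_ev refl)
  then show ?thesis by (simp add: complex_dirderiv_def)
qed

text \<open>Differentiation in \<open>z\<close> only uses the values on the slice on which \<open>\<zeta>\<close> is fixed. This allows a
  vector field in \<open>\<zeta>\<close> to be frozen at one point while \<open>z\<close>-derivatives are taken.\<close>

lemma z_derivs_eq_0_on_slice:
  fixes F :: "('n::finite) Qdom \<Rightarrow> complex"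
  assumes U: "open U" and van: "\<And>z. (z, \<zeta>) \<in> U \<Longrightarrow> F (z, \<zeta>) = 0" and z: "(z, \<zeta>) \<in> U"
  shows "z_derivs js F (z, \<zeta>) = 0"
  using z
proof (induction js arbitrary: z)
  case (Cons j js)
  have "complex_dirderiv (axis j 1, 0, 0) (z_derivs js F) (z, \<zeta>) = 0"
    by (rule complex_dirderiv_eq_0_on_line [OF U Cons.prems])
      (use Cons.IH in \<open>auto simp: zero_prod_def [symmetric]\<close>)
  then show ?case by simp
qed (use van in simp)

lemma complex_dirderiv_snd_slice:
  "complex_dirderiv (0, u) F (z, \<zeta>) = complex_dirderiv u (\<lambda>\<zeta>. F (z, \<zeta>)) \<zeta>"
  by (simp add: complex_dirderiv_def)

section \<open>Holomorphic nondegeneracy and vector fields\<close>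

abbreviation z_deriv_family :: "(('n::finite) Qdom \<Rightarrow> complex) \<Rightarrow> ('n \<Rightarrow> nat) \<Rightarrow> 'n pt \<Rightarrow> complex" where
  "z_deriv_family Q \<equiv> \<lambda>\<alpha> (\<xi>, \<tau>). z_deriv \<alpha> Q (0, \<xi>, \<tau>)"

lemma z_deriv_family_eq: "z_deriv_family Q \<alpha> = (\<lambda>\<zeta>. z_deriv \<alpha> Q (0, \<zeta>))"
  by (simp add: fun_eq_iff)

lemma holomorphically_nondegenerate_iff:
  "holomorphically_nondegenerate (Q :: ('n::finite) Qdom \<Rightarrow> complex) \<longleftrightarrow>
    (\<exists>\<rho>. inj \<rho> \<and> \<not> (\<forall>\<^sub>F \<zeta> in nhds 0. jacobian_minor (z_deriv_family Q) UNIV \<rho> \<zeta> = 0))"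
  (is "_ \<longleftrightarrow> (\<exists>\<rho>. ?P \<rho>)")
proof
  assume "\<exists>\<rho>. ?P \<rho>"
  then obtain \<rho> :: "'n option \<Rightarrow> 'n \<Rightarrow> nat" where \<rho>: "?P \<rho>" by blast
  have "range \<rho> \<subseteq> {\<alpha>. (\<Sum>j\<in>UNIV. \<alpha> j) \<le> Max (range (\<lambda>k. \<Sum>j\<in>UNIV. \<rho> k j))}"
    by auto
  with \<rho> show "holomorphically_nondegenerate Q"
    unfolding holomorphically_nondegenerate_def generic_rank_full_iff by blast
next
  assume "holomorphically_nondegenerate Q"
  then show "\<exists>\<rho>. ?P \<rho>"
    unfolding holomorphically_nondegenerate_def generic_rank_full_iff by blast
qed

text \<open>There is no nontrivial germ of a holomorphic vector field in \<open>\<zeta>\<close> that is tangent to \<open>w = Q (z, \<zeta>)\<close>: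
  such a field differentiates \<open>w - Q (z, \<zeta>)\<close> only through \<open>Q\<close>, and then its effect does not depend
  on \<open>w\<close>, so that it has to annihilate \<open>Q\<close> for all \<open>(z, \<zeta>)\<close>.\<close>

definition no_annihilating_field :: "(('n::finite) Qdom \<Rightarrow> complex) \<Rightarrow> bool" where
  "no_annihilating_field Q \<longleftrightarrow>
    (\<forall>a. holomorphic_germ a \<longrightarrow> (\<forall>\<^sub>F (z, \<zeta>) in nhds 0. complex_dirderiv (0, a \<zeta>) Q (z, \<zeta>) = 0) \<longrightarrow>
      (\<forall>\<^sub>F \<zeta> in nhds 0. a \<zeta> = 0))"

lemma holomorphic_map_on_z_deriv_family:
  assumes "Q holomorphic_map_on ball 0 r \<times> ball 0 r" "0 < r"
  shows "z_deriv_family Q \<alpha> holomorphic_map_on ball 0 r"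
proof -
  obtain js where js: "\<And>F. z_deriv \<alpha> F = z_derivs js F" by (rule z_deriv_eq_z_derivs [of \<alpha>]) blast
  show ?thesis
    unfolding z_deriv_family_eq unfolding js
    by (rule holomorphic_map_on_compose [OF _ holomorphic_map_on_z_derivs [OF assms(1)]])
      (use assms(2) in \<open>auto intro!: holomorphic_map_on_Pair holomorphic_map_on_const
          holomorphic_map_on_ident open_Times\<close>)
qed

text \<open>A field in \<open>\<zeta>\<close> that annihilates \<open>Q\<close> annihilates all \<open>z\<close>-derivatives of \<open>Q\<close>, since derivatives
  commute, and \<open>n + 1\<close> of them at \<open>z = 0\<close> have a Jacobian determinant that is a nonzero germ.\<close>

lemma no_annihilating_field_if_nondegenerate:
  fixes Q :: "('n::finite) Qdom \<Rightarrow> complex"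
  assumes Q: "holomorphic_germ Q" and nondeg: "holomorphically_nondegenerate Q"
  shows "no_annihilating_field Q"
  unfolding no_annihilating_field_def
proof (intro allI impI)
  fix a assume a: "holomorphic_germ a"
    and ann: "\<forall>\<^sub>F (z, \<zeta>) in nhds 0. complex_dirderiv (0, a \<zeta>) Q (z, \<zeta>) = 0"
  obtain V where V: "open V" "0 \<in> V" "Q holomorphic_map_on V"
    using Q unfolding holomorphic_germ_def by blast
  obtain s where s: "0 < s" "a holomorphic_map_on ball 0 s"
    using holomorphic_germ_ball [OF a] .
  have "\<forall>\<^sub>F p in nhds 0. p \<in> V \<and> snd p \<in> ball 0 s \<and> complex_dirderiv (0, a (snd p)) Q p = 0"
    using ann eventually_nhds_in_open [OF V(1,2)]
      eventually_continuous_0 [of "snd", OF _ _ eventually_nhds_in_open [OF open_ball, of 0 0 s]] s(1)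
    by (simp add: eventually_conj_iff case_prod_unfold continuous_on_snd)
  then obtain r where r: "0 < r" and
    *: "\<And>z \<zeta>. z \<in> ball 0 r \<Longrightarrow> \<zeta> \<in> ball 0 r \<Longrightarrow>
        (z, \<zeta>) \<in> V \<and> \<zeta> \<in> ball 0 s \<and> complex_dirderiv (0, a \<zeta>) Q (z, \<zeta>) = 0"
    unfolding eventually_nhds_0_prod_iff by auto
  let ?U = "ball (0::complex^'n) r \<times> ball (0::'n pt) r"
  have U: "open ?U" using ball_product [OF r] by blast
  have QU: "Q holomorphic_map_on ?U" using V(3) by (rule holomorphic_map_on_subset) (use * in auto)
  have aB: "a holomorphic_map_on ball 0 r" using s(2) * r
    by (intro holomorphic_map_on_subset [OF s(2)]) (metis centre_in_ball subsetI)
  obtain \<rho> :: "'n option \<Rightarrow> 'n \<Rightarrow> nat" where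
    \<rho>: "\<not> (\<forall>\<^sub>F \<zeta> in nhds 0. jacobian_minor (z_deriv_family Q) UNIV \<rho> \<zeta> = 0)"
    using nondeg unfolding holomorphically_nondegenerate_iff by blast
  have "complex_dirderiv (a \<zeta>) (z_deriv_family Q (\<rho> i)) \<zeta> = 0" if \<zeta>: "\<zeta> \<in> ball 0 r" for \<zeta> i
  proof -
    obtain js where js: "\<And>F. z_deriv (\<rho> i) F = z_derivs js F"
      by (rule z_deriv_eq_z_derivs [of "\<rho> i"]) blast
    have U0: "(0, \<zeta>) \<in> ?U" using \<zeta> r by simp
    have "complex_dirderiv (a \<zeta>) (z_deriv_family Q (\<rho> i)) \<zeta> =
        complex_dirderiv (0, a \<zeta>) (z_derivs js Q) (0, \<zeta>)"
      unfolding z_deriv_family_eq unfolding js complex_dirderiv_snd_slice ..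
    also have "\<dots> = z_derivs js (complex_dirderiv (0, a \<zeta>) Q) (0, \<zeta>)"
      by (rule complex_dirderiv_z_derivs_commute [OF QU U U0])
    also have "\<dots> = 0"
      by (rule z_derivs_eq_0_on_slice [OF U _ U0]) (use * in auto)
    finally show ?thesis .
  qed
  then have "a \<zeta> = 0" if "\<zeta> \<in> ball 0 r" for \<zeta>
    using annihilating_field_trivial [where \<phi> = "z_deriv_family Q" and \<rho> = \<rho>,
        OF open_ball convex_ball _ holomorphic_map_on_z_deriv_family [OF QU r] aB _ \<rho> that] r
    by simp
  then show "\<forall>\<^sub>F \<zeta> in nhds 0. a \<zeta> = 0"
    unfolding eventually_nhds using r by (intro exI [of _ "ball 0 r"]) auto
qed

lemma nonzero_germ_if_nonzero:
  fixes a :: "'a::complex_normed_vector \<Rightarrow> ('n::finite) pt"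
  assumes "open U" "convex U" "y \<in> U" "a holomorphic_map_on U" "x \<in> U" "a x \<noteq> 0"
  shows "\<not> (\<forall>\<^sub>F x in nhds y. a x = 0)"
proof
  assume "\<forall>\<^sub>F x in nhds y. a x = 0"
  then have "\<forall>\<^sub>F x in nhds y. coord (a x) k = 0" for k
    by (rule eventually_mono) (simp add: coord_def split: option.split)
  from holomorphic_identity [OF holomorphic_map_on_coord [OF assms(4)] assms(1-3) this assms(5)]
  show False using assms(6) coord_eq_0_iff by blast
qed

text \<open>Full Jacobian minors are multiplicative, so under either hypothesis the functions
  \<open>z_deriv \<alpha> Q (0, F \<zeta>)\<close> have generic rank at most \<open>n\<close>, and one field annihilates all of them. At a
  fixed \<open>\<zeta>\<close> this says that all \<open>z\<close>-derivatives at \<open>z = 0\<close> of the derivative of \<open>Q\<close> in the direction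
  \<open>(0, u)\<close> vanish, where \<open>u\<close> is the image of the field under the derivative of \<open>F\<close>. Hence that derivative
  vanishes for all \<open>z\<close>.\<close>

lemma annihilating_field_pullback:
  fixes Q :: "('n::finite) Qdom \<Rightarrow> complex" and F :: "'n pt \<Rightarrow> 'n pt"
  assumes Q: "holomorphic_germ Q" and F: "holomorphic_germ F" "F 0 = 0"
    and degenerate: "\<not> holomorphically_nondegenerate Q \<or> (\<forall>\<^sub>F \<zeta> in nhds 0. jacobian_det F \<zeta> = 0)"
  obtains a where "holomorphic_germ a" "\<not> (\<forall>\<^sub>F \<zeta> in nhds 0. a \<zeta> = 0)"
    "\<forall>\<^sub>F (z, \<zeta>) in nhds 0. \<exists>L. has_complex_derivative (\<lambda>\<zeta>. Q (z, F \<zeta>)) L \<zeta> \<and> L (a \<zeta>) = 0"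
proof -
  obtain V where V: "open V" "0 \<in> V" "Q holomorphic_map_on V"
    using Q unfolding holomorphic_germ_def by blast
  obtain r where r: "0 < r" "ball 0 r \<times> ball 0 r \<subseteq> V"
    using open_contains_ball_product [OF V(1,2)] .
  let ?U = "ball (0::complex^'n) r \<times> ball (0::'n pt) r"
  have U: "open ?U" "convex ?U" using ball_product [OF r(1)] by blast+
  have QU: "Q holomorphic_map_on ?U" using V(3) r(2) by (rule holomorphic_map_on_subset)
  note fam = holomorphic_map_on_z_deriv_family [OF QU r(1)]
  obtain s0 where s0: "0 < s0" "F holomorphic_map_on ball 0 s0"
    using holomorphic_germ_ball [OF F(1)] .
  have "\<forall>\<^sub>F \<zeta> in nhds 0. F \<zeta> \<in> ball 0 r"
    using r(1) by (intro eventually_holomorphic_germ [OF F] eventually_nhds_in_open) auto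
  moreover have "\<forall>\<^sub>F \<zeta> in nhds 0. \<zeta> \<in> ball (0::'n pt) s0"
    using s0(1) by (intro eventually_nhds_in_open) auto
  moreover have "\<forall>\<^sub>F \<zeta> in nhds 0. holomorphically_nondegenerate Q \<longrightarrow> jacobian_det F \<zeta> = 0"
    using degenerate by (cases "holomorphically_nondegenerate Q") auto
  ultimately have "\<forall>\<^sub>F \<zeta> in nhds 0. F \<zeta> \<in> ball 0 r \<and> \<zeta> \<in> ball 0 s0 \<and>
      (holomorphically_nondegenerate Q \<longrightarrow> jacobian_det F \<zeta> = 0)"
    by eventually_elim simp
  then obtain s where s: "0 < s" and
    *: "\<And>\<zeta>. \<zeta> \<in> ball 0 s \<Longrightarrow> F \<zeta> \<in> ball 0 r \<and> \<zeta> \<in> ball 0 s0 \<and>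
      (holomorphically_nondegenerate Q \<longrightarrow> jacobian_det F \<zeta> = 0)"
    unfolding eventually_nhds_metric by (metis dist_commute mem_ball)
  have Fs: "F holomorphic_map_on ball 0 s"
    by (rule holomorphic_map_on_subset [OF s0(2)]) (use * in blast)
  let ?\<psi> = "\<lambda>\<alpha> \<zeta>. z_deriv_family Q \<alpha> (F \<zeta>)"
  have \<psi>: "?\<psi> \<alpha> holomorphic_map_on ball 0 s" for \<alpha>
    by (rule holomorphic_map_on_compose [OF Fs fam]) (use * in blast)
  have minors: "jacobian_minor ?\<psi> UNIV \<rho> \<zeta> = 0"
    if inj: "inj \<rho>" and \<zeta>: "\<zeta> \<in> ball 0 s" for \<rho> :: "'n option \<Rightarrow> 'n \<Rightarrow> nat" and \<zeta>
  proof -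
    have "jacobian_minor (z_deriv_family Q) UNIV \<rho> (F \<zeta>) * jacobian_det F \<zeta> = 0"
    proof (cases "holomorphically_nondegenerate Q")
      case False
      then have ev: "\<forall>\<^sub>F \<zeta> in nhds 0. jacobian_minor (z_deriv_family Q) UNIV \<rho> \<zeta> = 0"
        using inj unfolding holomorphically_nondegenerate_iff by blast
      have "jacobian_minor (z_deriv_family Q) UNIV \<rho> (F \<zeta>) = 0"
        by (rule holomorphic_identity [OF holomorphic_map_on_jacobian_minor
              [where \<phi> = "z_deriv_family Q" and \<rho> = \<rho>, OF fam open_ball]
              open_ball convex_ball _ ev]) (use r(1) * [OF \<zeta>] in auto)
      then show ?thesis by simp
    qed (use * [OF \<zeta>] in simp)
    moreover have "jacobian_minor ?\<psi> UNIV \<rho> \<zeta> =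
        jacobian_minor (z_deriv_family Q) UNIV \<rho> (F \<zeta>) * jacobian_det F \<zeta>"
      by (rule jacobian_minor_compose [where \<phi> = "z_deriv_family Q" and \<rho> = \<rho>, OF Fs \<zeta> fam]) (use * [OF \<zeta>] in blast)
    ultimately show ?thesis by simp
  qed
  obtain a where a: "a holomorphic_map_on ball 0 s" "\<exists>x\<in>ball 0 s. a x \<noteq> 0"
    "\<And>\<alpha> \<zeta>. \<zeta> \<in> ball 0 s \<Longrightarrow> complex_dirderiv (a \<zeta>) (?\<psi> \<alpha>) \<zeta> = 0"
  proof (rule annihilating_field_exists [of "ball 0 s" UNIV ?\<psi>])
    show "ball (0::'n pt) s \<noteq> {}" using s by simp
  qed (use \<psi> minors in auto)
  have ann: "\<exists>L. has_complex_derivative (\<lambda>\<zeta>. Q (z, F \<zeta>)) L \<zeta> \<and> L (a \<zeta>) = 0"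
    if z: "z \<in> ball 0 r" and \<zeta>: "\<zeta> \<in> ball 0 s" for z \<zeta>
  proof -
    obtain L where L: "has_complex_derivative F L \<zeta>"
      using Fs \<zeta> unfolding holomorphic_map_on_iff by blast
    define u where "u = L (a \<zeta>)"
    have F\<zeta>: "F \<zeta> \<in> ball 0 r" using * [OF \<zeta>] by blast
    have U0: "(0, F \<zeta>) \<in> ?U" using F\<zeta> r(1) by simp
    have "z_derivs js (complex_dirderiv (0, u) Q) (0, F \<zeta>) = 0" for js
    proof -
      have "z_derivs js (complex_dirderiv (0, u) Q) (0, F \<zeta>) = complex_dirderiv (0, u) (z_derivs js Q) (0, F \<zeta>)"
        by (rule complex_dirderiv_z_derivs_commute [OF QU U(1) U0, symmetric])
      also have "\<dots> = complex_dirderiv (0, u) (z_deriv (count_list js) Q) (0, F \<zeta>)"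
        by (rule complex_dirderiv_cong_open [OF U(1) U0 z_deriv_count_list [OF QU U(1), symmetric]])
      also have "\<dots> = complex_dirderiv u (z_deriv_family Q (count_list js)) (F \<zeta>)"
        unfolding z_deriv_family_eq unfolding complex_dirderiv_snd_slice ..
      also have "\<dots> = complex_dirderiv (a \<zeta>) (?\<psi> (count_list js)) \<zeta>"
        unfolding u_def by (rule complex_dirderiv_compose [OF L fam F\<zeta>, symmetric])
      finally show ?thesis using a(3) [OF \<zeta>] by simp
    qed
    then have "complex_dirderiv (0, u) Q (z, F \<zeta>) = 0"
      by (intro eq_0_if_z_derivs_eq_0 [OF holomorphic_map_on_complex_dirderiv [OF QU U(1)] U U0])
        (use z F\<zeta> in auto)
    moreover have "has_complex_derivative (\<lambda>\<zeta>. Q (z, F \<zeta>))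
        (\<lambda>v. complex_dirderiv (0, L v) Q (z, F \<zeta>)) \<zeta>"
      by (rule has_complex_derivative_compose
          [OF has_complex_derivative_Pair [OF has_complex_derivative_const L]
            has_complex_derivative_dirderiv [OF QU]])
        (use z F\<zeta> in auto)
    ultimately show ?thesis unfolding u_def by blast
  qed
  show thesis
  proof (rule that)
    show "holomorphic_germ a" by (rule holomorphic_germI [OF open_ball _ a(1)]) (use s in simp)
    show "\<not> (\<forall>\<^sub>F \<zeta> in nhds 0. a \<zeta> = 0)"
      using a(2) nonzero_germ_if_nonzero
        [OF open_ball convex_ball centre_in_ball [THEN iffD2, OF s] a(1)] by blast
    show "\<forall>\<^sub>F (z, \<zeta>) in nhds 0.
        \<exists>L. has_complex_derivative (\<lambda>\<zeta>. Q (z, F \<zeta>)) L \<zeta> \<and> L (a \<zeta>) = 0"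
      unfolding eventually_nhds_0_prod_iff
      by (rule exI [of _ "min r s"]) (use r s ann in auto)
  qed
qed

text \<open>The components of \<open>F\<close> form a family whose full minors are the Jacobian determinant up to sign.\<close>

lemma kernel_field_exists:
  fixes F :: "('n::finite) pt \<Rightarrow> 'n pt"
  assumes F: "holomorphic_germ F" and det: "\<forall>\<^sub>F Z in nhds 0. jacobian_det F Z = 0"
  obtains a where "holomorphic_germ a" "\<not> (\<forall>\<^sub>F Z in nhds 0. a Z = 0)"
    "\<forall>\<^sub>F Z in nhds 0. \<exists>L. has_complex_derivative F L Z \<and> L (a Z) = 0"
proof -
  obtain S where S: "open S" "0 \<in> S" "F holomorphic_map_on S"
    using F unfolding holomorphic_germ_def by blast
  have "\<forall>\<^sub>F Z in nhds 0. Z \<in> S \<and> jacobian_det F Z = 0"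
    using eventually_nhds_in_open [OF S(1,2)] det by eventually_elim simp
  then obtain s where s: "0 < s" and *: "\<And>Z. Z \<in> ball 0 s \<Longrightarrow> Z \<in> S \<and> jacobian_det F Z = 0"
    unfolding eventually_nhds_metric by (metis dist_commute mem_ball)
  have Fs: "F holomorphic_map_on ball 0 s"
    by (rule holomorphic_map_on_subset [OF S(3)]) (use * in blast)
  obtain a where a: "a holomorphic_map_on ball 0 s" "\<exists>x\<in>ball 0 s. a x \<noteq> 0"
    "\<And>k Z. Z \<in> ball 0 s \<Longrightarrow> complex_dirderiv (a Z) (\<lambda>Z. coord (F Z) k) Z = 0"
  proof (rule annihilating_field_exists [of "ball 0 s" UNIV "\<lambda>k Z. coord (F Z) k"])
    show "ball (0::'n pt) s \<noteq> {}" using s by simp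
    show "jacobian_minor (\<lambda>k Z. coord (F Z) k) UNIV \<rho> Z = 0" if "inj \<rho>" "Z \<in> ball 0 s" for \<rho> Z
      using * [OF that(2)] by (simp add: jacobian_minor_coord_permuted [OF that(1)])
  qed (use holomorphic_map_on_coord [OF Fs] in auto)
  have "\<exists>L. has_complex_derivative F L Z \<and> L (a Z) = 0" if Z: "Z \<in> ball 0 s" for Z
  proof -
    obtain L where L: "has_complex_derivative F L Z"
      using Fs Z unfolding holomorphic_map_on_iff by blast
    have "coord (L (a Z)) k = 0" for k
      using a(3) [OF Z, of k] coord_has_complex_derivative [OF L] by (metis complex_dirderiv_eq)
    with L show ?thesis using coord_eq_0_iff by blast
  qed
  then have ev: "\<forall>\<^sub>F Z in nhds 0. \<exists>L. has_complex_derivative F L Z \<and> L (a Z) = 0"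
    unfolding eventually_nhds using s by (intro exI [of _ "ball 0 s"]) auto
  show thesis
  proof (rule that [OF _ _ ev])
    show "holomorphic_germ a" by (rule holomorphic_germI [OF open_ball _ a(1)]) (use s in simp)
    show "\<not> (\<forall>\<^sub>F \<zeta> in nhds 0. a \<zeta> = 0)"
      using a(2) nonzero_germ_if_nonzero
        [OF open_ball convex_ball centre_in_ball [THEN iffD2, OF s] a(1)] by blast
  qed
qed

section \<open>Extending identities off the hypersurface\<close>

text \<open>The vector field has coefficients in \<open>\<zeta>\<close> only, so it commutes with the derivative in \<open>w\<close> and
  annihilates all \<open>w\<close>-derivatives of \<open>R\<close>. If one of these vanishes on \<open>w = Q (z, \<zeta>)\<close>, then applying
  the field along the hypersurface gives the product of the next \<open>w\<close>-derivative with the field applied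
  to \<open>Q\<close>. The second factor is not identically zero, so the next \<open>w\<close>-derivative vanishes there as well. Thus
  all of them vanish on the hypersurface, and Taylor expansion in \<open>w\<close> shows that \<open>R\<close> vanishes off it.\<close>

lemma vanishes_off_hypersurface:
  fixes Q :: "('n::finite) Qdom \<Rightarrow> complex" and R :: "'n pt \<times> 'n pt \<Rightarrow> complex"
  assumes Q: "holomorphic_germ Q" "Q 0 = 0" "no_annihilating_field Q"
    and R: "holomorphic_germ R" "\<forall>\<^sub>F (z, \<zeta>) in nhds 0. R ((z, Q (z, \<zeta>)), \<zeta>) = 0"
    and a: "holomorphic_germ a" "\<not> (\<forall>\<^sub>F \<zeta> in nhds 0. a \<zeta> = 0)"
    and ann: "\<forall>\<^sub>F (Z, \<zeta>) in nhds 0. complex_dirderiv (0, a \<zeta>) R (Z, \<zeta>) = 0"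
  shows "\<forall>\<^sub>F p in nhds 0. R p = 0"
proof -
  obtain A where A: "open A" "0 \<in> A" "a holomorphic_map_on A"
    using a unfolding holomorphic_germ_def by blast
  obtain WR where WR: "open WR" "0 \<in> WR" "R holomorphic_map_on WR"
    using R unfolding holomorphic_germ_def by blast
  obtain V where V: "open V" "0 \<in> V" "Q holomorphic_map_on V"
    using Q unfolding holomorphic_germ_def by blast
  have evA: "\<forall>\<^sub>F p :: 'n pt \<times> 'n pt in nhds 0. snd p \<in> A"
    by (rule eventually_continuous_0 [OF _ _ eventually_nhds_in_open [OF A(1,2)]])
      (auto intro: continuous_intros)
  have "\<forall>\<^sub>F p in nhds 0. p \<in> WR \<and> snd p \<in> A \<and> complex_dirderiv (0, a (snd p)) R p = 0"
    using ann eventually_nhds_in_open [OF WR(1,2)] evA by eventually_elim auto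
  then obtain s where s: "0 < s" and
    sW: "\<And>Z \<zeta>. Z \<in> ball 0 s \<Longrightarrow> \<zeta> \<in> ball 0 s \<Longrightarrow>
      (Z, \<zeta>) \<in> WR \<and> \<zeta> \<in> A \<and> complex_dirderiv (0, a \<zeta>) R (Z, \<zeta>) = 0"
    unfolding eventually_nhds_0_prod_iff by auto
  let ?W = "ball (0::'n pt) s \<times> ball (0::'n pt) s"
  have W: "open ?W" "convex ?W" using ball_product [OF s] by blast+
  have RW: "R holomorphic_map_on ?W" using WR(3) by (rule holomorphic_map_on_subset) (use sW in auto)
  let ?\<Psi> = "\<lambda>p :: 'n Qdom. ((fst p, Q p), snd p)"
  have \<Psi>V: "?\<Psi> holomorphic_map_on V"
    by (intro holomorphic_map_on_Pair holomorphic_map_on_fst holomorphic_map_on_snd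
        holomorphic_map_on_ident V(3))
  have "\<forall>\<^sub>F p in nhds 0. ?\<Psi> p \<in> ?W"
    by (rule eventually_holomorphic_germ [OF holomorphic_germI [OF V(1,2) \<Psi>V]])
      (use Q(2) W(1) s in \<open>auto simp: zero_prod_def intro!: eventually_nhds_in_open\<close>)
  with R(2) eventually_nhds_in_open [OF V(1,2)]
  have "\<forall>\<^sub>F p in nhds 0. p \<in> V \<and> ?\<Psi> p \<in> ?W \<and> R (?\<Psi> p) = 0"
    by eventually_elim auto
  then obtain r where r: "0 < r" and
    rU: "\<And>z \<zeta>. z \<in> ball 0 r \<Longrightarrow> \<zeta> \<in> ball 0 r \<Longrightarrow>
      (z, \<zeta>) \<in> V \<and> ?\<Psi> (z, \<zeta>) \<in> ?W \<and> R (?\<Psi> (z, \<zeta>)) = 0"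
    unfolding eventually_nhds_0_prod_iff by auto
  let ?U = "ball (0::complex^'n) r \<times> ball (0::'n pt) r"
  have U: "open ?U" "convex ?U" "0 \<in> ?U" using ball_product [OF r] by blast+
  have UV: "?U \<subseteq> V" and UW: "\<And>p. p \<in> ?U \<Longrightarrow> ?\<Psi> p \<in> ?W" and UR: "\<And>p. p \<in> ?U \<Longrightarrow> R (?\<Psi> p) = 0"
    using rU by auto
  have UA: "snd p \<in> A" if "p \<in> ?U" for p
    using UW [OF that] sW [of 0 "snd p"] s by simp
  have QU: "Q holomorphic_map_on ?U" using V(3) UV by (rule holomorphic_map_on_subset)
  have \<Psi>U: "?\<Psi> holomorphic_map_on ?U" using \<Psi>V UV by (rule holomorphic_map_on_subset)
  let ?e = "((0, 1), 0) :: 'n pt \<times> 'n pt"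
  let ?R = "\<lambda>k. (complex_dirderiv ?e ^^ k) R"
  have Rk: "?R k holomorphic_map_on ?W" for k
    by (induction k) (use RW holomorphic_map_on_complex_dirderiv [OF _ W(1)] in auto)
  have annk: "complex_dirderiv (0, a (snd p)) (?R k) p = 0" if "p \<in> ?W" for p k
    using that
  proof (induction k arbitrary: p)
    case 0
    then show ?case using sW by auto
  next
    case (Suc k)
    have "complex_dirderiv (0, a (snd p)) (?R (Suc k)) p =
        complex_dirderiv ?e (complex_dirderiv (0, a (snd p)) (?R k)) p"
      using complex_dirderiv_commute [OF Rk W(1) Suc.prems] by simp
    also have "\<dots> = 0"
    proof (rule complex_dirderiv_eq_0_on_line [OF W(1) Suc.prems])
      fix t assume "p + t *\<^sub>C ?e \<in> ?W"
      from Suc.IH [OF this]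
      show "complex_dirderiv (0, a (snd p)) (?R k) (p + t *\<^sub>C ?e) = 0" by simp
    qed
    finally show ?case .
  qed
  let ?X = "\<lambda>p. complex_dirderiv (0, a (snd p)) Q p"
  have aU: "(\<lambda>p. (0, a (snd p)) :: 'n Qdom) holomorphic_map_on ?U"
    by (intro holomorphic_map_on_Pair holomorphic_map_on_const
        holomorphic_map_on_compose [OF holomorphic_map_on_snd [OF holomorphic_map_on_ident] A(3)] UA)
  have XU: "?X holomorphic_map_on ?U"
    by (rule holomorphic_map_on_complex_dirderiv_field [OF QU U(1) aU])
  have X0: "\<not> (\<forall>p\<in>?U. ?X p = 0)"
  proof
    assume "\<forall>p\<in>?U. ?X p = 0"
    then have "\<forall>\<^sub>F (z, \<zeta>) in nhds 0. complex_dirderiv (0, a \<zeta>) Q (z, \<zeta>) = 0"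
      unfolding eventually_nhds_0_prod_iff using r by auto
    with Q(3) a show False unfolding no_annihilating_field_def by blast
  qed
  have Sk: "?R k (?\<Psi> p) = 0" if "p \<in> ?U" for k p
    using that
  proof (induction k arbitrary: p)
    case 0
    then show ?case using UR [OF 0] by simp
  next
    case (Suc k)
    have "(\<forall>p\<in>?U. ?R (Suc k) (?\<Psi> p) = 0) \<or> (\<forall>p\<in>?U. ?X p = 0)"
    proof (rule holomorphic_mult_eq_0 [OF U(1,2) _ XU])
      show "(\<lambda>p. ?R (Suc k) (?\<Psi> p)) holomorphic_map_on ?U"
        by (rule holomorphic_map_on_compose [OF \<Psi>U Rk UW])
      fix p assume p: "p \<in> ?U"
      let ?v = "(0, a (snd p)) :: 'n Qdom"
      note DQ = has_complex_derivative_dirderiv [OF QU p]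
      have D\<Psi>: "has_complex_derivative ?\<Psi> (\<lambda>v. ((fst v, complex_dirderiv v Q p), snd v)) p"
        by (intro has_complex_derivative_Pair DQ has_complex_derivative_bounded_linear
            bounded_linear_fst bounded_linear_snd) auto
      have "0 = complex_dirderiv ?v (\<lambda>p. ?R k (?\<Psi> p)) p"
        by (rule complex_dirderiv_eq_0_on_line [OF U(1) p Suc.IH, symmetric])
      also have "\<dots> = complex_dirderiv ((0, ?X p), a (snd p)) (?R k) (?\<Psi> p)"
        using complex_dirderiv_compose [OF D\<Psi> Rk UW [OF p], of ?v k] by simp
      \<comment> \<open>the image of the field splits into a multiple of \<open>?e\<close> and the field itself, which annihilates \<open>?R k\<close>\<close>
      also have "((0, ?X p), a (snd p)) = ?X p *\<^sub>C ?e + (0, a (snd (?\<Psi> p)))"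
        by (simp add: zero_prod_def)
      also have "complex_dirderiv \<dots> (?R k) (?\<Psi> p) =
          ?X p * ?R (Suc k) (?\<Psi> p) + complex_dirderiv (0, a (snd (?\<Psi> p))) (?R k) (?\<Psi> p)"
        by (simp only: complex_dirderiv_linear(1,2) [OF Rk UW [OF p]] funpow.simps o_def)
      finally show "?R (Suc k) (?\<Psi> p) * ?X p = 0"
        using annk [OF UW [OF p]] by (simp add: mult.commute)
    qed
    then show ?case using X0 Suc.prems by blast
  qed
  have "R (Z, \<zeta>) = 0" if Z: "Z \<in> ball 0 (min r s)" and \<zeta>: "\<zeta> \<in> ball 0 (min r s)" for Z \<zeta>
  proof -
    obtain z w where zw: "Z = (z, w)" by (cases Z)
    have "z \<in> ball 0 r" using Z norm_fst_le [of z w] by (simp add: zw)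
    then have p: "(z, \<zeta>) \<in> ?U" using \<zeta> by simp
    have eq: "(Z, \<zeta>) = ?\<Psi> (z, \<zeta>) + (w - Q (z, \<zeta>)) *\<^sub>C ?e" by (simp add: zw zero_prod_def)
    have "R (?\<Psi> (z, \<zeta>) + (w - Q (z, \<zeta>)) *\<^sub>C ?e) = 0"
      by (rule eq_0_if_dirderivs_eq_0 [OF RW W UW [OF p] _ Sk [OF p]])
        (use Z \<zeta> in \<open>simp only: eq [symmetric], simp\<close>)
    then show ?thesis by (simp only: eq)
  qed
  then show ?thesis
    unfolding eventually_nhds_0_prod_iff using r s by (intro exI [of _ "min r s"]) auto
qed

section \<open>Conjugation\<close>

definition pt_cnj :: "('n::finite) pt \<Rightarrow> 'n pt" where
  "pt_cnj v = (vcnj (fst v), cnj (snd v))"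

definition Qdom_cnj :: "('n::finite) Qdom \<Rightarrow> 'n Qdom" where
  "Qdom_cnj x = (vcnj (fst x), pt_cnj (snd x))"

lemma bounded_linear_vcnj: "bounded_linear (vcnj :: complex ^ ('n::finite) \<Rightarrow> complex ^ 'n)"
  by (rule linear_conv_bounded_linear [THEN iffD1], rule linearI)
    (simp_all add: vcnj_def vec_eq_iff)

lemma bounded_linear_pt_cnj: "bounded_linear (pt_cnj :: ('n::finite) pt \<Rightarrow> 'n pt)"
  unfolding pt_cnj_def [abs_def]
  by (intro bounded_linear_Pair bounded_linear_compose [OF bounded_linear_vcnj bounded_linear_fst]
      bounded_linear_compose [OF bounded_linear_cnj bounded_linear_snd])

lemma bounded_linear_Qdom_cnj: "bounded_linear (Qdom_cnj :: ('n::finite) Qdom \<Rightarrow> 'n Qdom)"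
  unfolding Qdom_cnj_def [abs_def]
  by (intro bounded_linear_Pair bounded_linear_compose [OF bounded_linear_vcnj bounded_linear_fst]
      bounded_linear_compose [OF bounded_linear_pt_cnj bounded_linear_snd])

lemma vcnj_simps [simp]: "vcnj (vcnj z) = z" "vcnj (c *\<^sub>C z) = cnj c *\<^sub>C vcnj z" "vcnj 0 = 0"
  by (simp_all add: vcnj_def vec_eq_iff)

lemma pt_cnj_simps [simp]: "pt_cnj (pt_cnj v) = v" "pt_cnj (c *\<^sub>C v) = cnj c *\<^sub>C pt_cnj v" "pt_cnj 0 = 0"
  by (simp_all add: pt_cnj_def prod_eq_iff)

lemma Qdom_cnj_simps [simp]:
  "Qdom_cnj (Qdom_cnj x) = x" "Qdom_cnj (c *\<^sub>C x) = cnj c *\<^sub>C Qdom_cnj x" "Qdom_cnj 0 = 0"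
  by (simp_all add: Qdom_cnj_def prod_eq_iff)

lemma conj_fun_eq: "conj_fun Q = (\<lambda>x. cnj (Q (Qdom_cnj x)))"
  by (auto simp: conj_fun_def Qdom_cnj_def pt_cnj_def)

text \<open>The antilinearity of the conjugations before and after \<open>F\<close> cancels.\<close>

lemma has_complex_derivative_conjugate:
  assumes F: "has_complex_derivative F L (c x)"
    and c: "bounded_linear c" "\<And>t v. c (t *\<^sub>C v) = cnj t *\<^sub>C c v"
    and c': "bounded_linear c'" "\<And>t v. c' (t *\<^sub>C v) = cnj t *\<^sub>C c' v"
  shows "has_complex_derivative (\<lambda>x. c' (F (c x))) (\<lambda>v. c' (L (c v))) x"
  unfolding has_complex_derivative_def
proof (intro conjI allI)
  have FL: "(F has_derivative L) (at (c x))" and L: "\<And>t v. L (t *\<^sub>C v) = t *\<^sub>C L v"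
    using F unfolding has_complex_derivative_def by blast+
  have "((\<lambda>x. F (c x)) has_derivative (\<lambda>v. L (c v))) (at x)"
    by (rule has_derivative_compose [OF bounded_linear_imp_has_derivative [OF c(1)] FL])
  then show "((\<lambda>x. c' (F (c x))) has_derivative (\<lambda>v. c' (L (c v)))) (at x)"
    by (rule bounded_linear.has_derivative [OF c'(1)])
  show "c' (L (c (t *\<^sub>C v))) = t *\<^sub>C c' (L (c v))" for t v
    by (simp only: c(2) L c'(2) complex_cnj_cnj)
qed

lemma holomorphic_germ_conjugate:
  assumes F: "holomorphic_germ F"
    and c: "bounded_linear c" "\<And>t v. c (t *\<^sub>C v) = cnj t *\<^sub>C c v"
    and c': "bounded_linear c'" "\<And>t v. c' (t *\<^sub>C v) = cnj t *\<^sub>C c' v"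
  shows "holomorphic_germ (\<lambda>x. c' (F (c x)))"
proof -
  obtain S where S: "open S" "0 \<in> S" "F holomorphic_map_on S"
    using F unfolding holomorphic_germ_def by blast
  show ?thesis
  proof (rule holomorphic_germI [of "c -` S"])
    show "open (c -` S)"
      by (rule open_vimage [OF S(1)]) (rule linear_continuous_on [OF c(1)])
    show "0 \<in> c -` S" using S(2) linear_0 [OF bounded_linear.linear [OF c(1)]] by simp
    show "(\<lambda>x. c' (F (c x))) holomorphic_map_on c -` S"
      unfolding holomorphic_map_on_iff
    proof
      fix x assume "x \<in> c -` S"
      then obtain L where "has_complex_derivative F L (c x)"
        using S(3) unfolding holomorphic_map_on_iff by blast
      from has_complex_derivative_conjugate [OF this c c']
      show "\<exists>L. has_complex_derivative (\<lambda>x. c' (F (c x))) L x"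
        by (rule exI [where x = "\<lambda>v. c' (L (c v))"])
    qed
  qed
qed

lemma holomorphic_germ_conj_fun:
  "holomorphic_germ (Q :: ('n::finite) Qdom \<Rightarrow> complex) \<Longrightarrow> holomorphic_germ (conj_fun Q)"
  unfolding conj_fun_eq
  by (rule holomorphic_germ_conjugate) (auto intro: bounded_linear_Qdom_cnj bounded_linear_cnj)

lemma complex_dirderiv_conj_fun:
  assumes "Q holomorphic_map_on S" "Qdom_cnj x \<in> S"
  shows "complex_dirderiv v (conj_fun Q) x = cnj (complex_dirderiv (Qdom_cnj v) Q (Qdom_cnj x))"
  unfolding conj_fun_eq
  by (rule complex_dirderiv_eq, rule has_complex_derivative_conjugate
      [OF has_complex_derivative_dirderiv [OF assms] bounded_linear_Qdom_cnj _ bounded_linear_cnj])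
    auto

text \<open>The conjugate of a field that annihilates \<open>conj_fun Q\<close> is holomorphic and annihilates \<open>Q\<close>.\<close>

lemma no_annihilating_field_conj_fun:
  fixes Q :: "('n::finite) Qdom \<Rightarrow> complex"
  assumes Q: "holomorphic_germ Q" and no: "no_annihilating_field Q"
  shows "no_annihilating_field (conj_fun Q)"
  unfolding no_annihilating_field_def
proof (intro allI impI)
  fix a assume a: "holomorphic_germ a"
    and ann: "\<forall>\<^sub>F (z, \<zeta>) in nhds 0. complex_dirderiv (0, a \<zeta>) (conj_fun Q) (z, \<zeta>) = 0"
  obtain V where V: "open V" "0 \<in> V" "Q holomorphic_map_on V"
    using Q unfolding holomorphic_germ_def by blast
  let ?a = "\<lambda>\<zeta>. pt_cnj (a (pt_cnj \<zeta>))"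
  have "holomorphic_germ ?a"
    using a by (rule holomorphic_germ_conjugate) (auto intro: bounded_linear_pt_cnj)
  moreover have "\<forall>\<^sub>F (z, \<zeta>) in nhds 0. complex_dirderiv (0, ?a \<zeta>) Q (z, \<zeta>) = 0"
  proof -
    have "\<forall>\<^sub>F p in nhds 0. (case Qdom_cnj p of (z, \<zeta>) \<Rightarrow> complex_dirderiv (0, a \<zeta>) (conj_fun Q) (z, \<zeta>) = 0)"
      by (rule eventually_continuous_0 [OF linear_continuous_on [OF bounded_linear_Qdom_cnj] _ ann]) simp
    moreover have "\<forall>\<^sub>F p in nhds 0. p \<in> V" using V(1,2) by (rule eventually_nhds_in_open)
    ultimately show ?thesis
    proof eventually_elim
      case (elim p)
      obtain z \<zeta> where p: "p = (z, \<zeta>)" by (cases p)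
      have "complex_dirderiv (0, a (pt_cnj \<zeta>)) (conj_fun Q) (Qdom_cnj p) =
          cnj (complex_dirderiv (0, ?a \<zeta>) Q p)"
        using complex_dirderiv_conj_fun [OF V(3), of "Qdom_cnj p"] elim(2)
        by (simp add: Qdom_cnj_def [of "(0, _)"])
      with elim(1) show ?case by (simp add: p Qdom_cnj_def)
    qed
  qed
  ultimately have "\<forall>\<^sub>F \<zeta> in nhds 0. ?a \<zeta> = 0"
    using no unfolding no_annihilating_field_def by blast
  then have "\<forall>\<^sub>F \<zeta> in nhds 0. ?a (pt_cnj \<zeta>) = 0"
    by (rule eventually_continuous_0 [rotated 2]) (auto intro: linear_continuous_on bounded_linear_pt_cnj)
  then show "\<forall>\<^sub>F \<zeta> in nhds 0. a \<zeta> = 0"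
    by (rule eventually_mono) (metis pt_cnj_simps(1,3))
qed

section \<open>Holomorphic inverse function theorem\<close>

text \<open>The real component \<open>v \<bullet> i\<close> is the real part of the complex linear functional
  \<open>v \<bullet> i - \<i> * ((\<i> *\<^sub>C v) \<bullet> i)\<close>. Composed with \<open>F\<close>, this is a holomorphic function, whose directional
  derivatives are continuous.\<close>

lemma continuous_on_map_derivative:
  fixes F :: "'a::{complex_normed_vector,euclidean_space} \<Rightarrow> 'a"
  assumes F: "F holomorphic_map_on S" "open S"
  obtains F' where "\<And>x. x \<in> S \<Longrightarrow> has_complex_derivative F (blinfun_apply (F' x)) x"
    "continuous_on S F'"
proof -
  define ell where "ell = (\<lambda>(i::'a) (v::'a). complex_of_real (v \<bullet> i) - \<i> * complex_of_real ((\<i> *\<^sub>C v) \<bullet> i))"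
  have "\<forall>x\<in>S. \<exists>L. has_complex_derivative F L x" using F(1) by (simp add: holomorphic_map_on_iff)
  then obtain L where L: "\<And>x. x \<in> S \<Longrightarrow> has_complex_derivative F (L x) x" by metis
  define F' where "F' = (\<lambda>x. Blinfun (L x))"
  have F': "blinfun_apply (F' x) = L x" if "x \<in> S" for x
    unfolding F'_def using L [OF that]
    by (intro bounded_linear_Blinfun_apply)
      (auto simp: has_complex_derivative_def has_derivative_bounded_linear)
  have lin: "bounded_linear (ell i)" for i
    unfolding ell_def
    by (intro bounded_linear_sub bounded_linear_const_mult bounded_linear_compose [OF bounded_linear_of_real]
        bounded_linear_inner_left bounded_linear_compose [OF bounded_linear_inner_left]
        bounded_bilinear.bounded_linear_right [OF bounded_bilinear_scaleC])
  have clin: "ell i (c *\<^sub>C v) = c *\<^sub>C ell i v" for c i v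
  proof -
    have c: "c *\<^sub>C w = Re c *\<^sub>R w + Im c *\<^sub>R (\<i> *\<^sub>C w)" for w :: 'a
    proof -
      have "c *\<^sub>C w = (of_real (Re c) + of_real (Im c) * \<i>) *\<^sub>C w"
        using complex_eq [of c] by (simp add: mult.commute)
      also have "\<dots> = of_real (Re c) *\<^sub>C w + of_real (Im c) *\<^sub>C (\<i> *\<^sub>C w)"
        by (simp only: scaleC_add_left scaleC_scaleC)
      finally show ?thesis by (simp only: scaleC_of_real)
    qed
    have ii: "\<i> *\<^sub>C (\<i> *\<^sub>C v) = - v"
      using scaleC_of_real [of "-1" v] by (simp add: scaleC_scaleC)
    have ic: "\<i> *\<^sub>C (c *\<^sub>C v) = Re c *\<^sub>R (\<i> *\<^sub>C v) - Im c *\<^sub>R v"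
      using c [of "\<i> *\<^sub>C v"] by (simp add: scaleC_scaleC [symmetric] ii)
        (simp add: scaleC_scaleC mult.commute)
    show ?thesis
      unfolding ell_def ic
      by (simp add: c [of v] inner_add_left inner_diff_left complex_eq_iff algebra_simps)
  qed
  have "continuous_on S F'"
  proof (rule continuous_at_imp_continuous_on, rule ballI, rule continuous_blinfun_componentwiseI)
    fix x i j :: 'a assume "x \<in> S" "i \<in> Basis" "j \<in> Basis"
    have "(\<lambda>x. ell i (F x)) holomorphic_map_on S"
      by (rule holomorphic_map_on_compose [OF F(1) holomorphic_map_on_bounded_linear [OF lin clin]])
        (rule UNIV_I)
    then have "continuous_on S (complex_dirderiv j (\<lambda>x. ell i (F x)))"
      by (rule continuous_on_complex_dirderiv) (rule F(2))
    then have "continuous_on S (\<lambda>x. Re (complex_dirderiv j (\<lambda>x. ell i (F x)) x))"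
      by (rule continuous_on_Re)
    then have "continuous_on S (\<lambda>x. blinfun_apply (F' x) j \<bullet> i)"
    proof (rule continuous_on_eq)
      fix y assume y: "y \<in> S"
      have "complex_dirderiv j (\<lambda>x. ell i (F x)) y = ell i (L y j)"
        by (rule complex_dirderiv_eq, rule has_complex_derivative_compose [OF L [OF y]])
          (rule has_complex_derivative_bounded_linear [OF lin clin])
      then show "Re (complex_dirderiv j (\<lambda>x. ell i (F x)) y) = blinfun_apply (F' y) j \<bullet> i"
        by (simp add: ell_def F' [OF y])
    qed
    then show "continuous (at x) (\<lambda>x. blinfun_apply (F' x) j \<bullet> i)"
      using F(2) \<open>x \<in> S\<close> continuous_on_eq_continuous_at by blast
  qed
  then show thesis using that [of F'] L F' by simp
qed

text \<open>The real inverse function theorem gives a differentiable inverse, and its derivative is complex linear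
  as the inverse of a complex linear map.\<close>

lemma biholomorphic_near_if_injective_derivative:
  fixes F :: "'a::{complex_normed_vector,euclidean_space} \<Rightarrow> 'a"
  assumes F: "F holomorphic_map_on S" "open S" "p \<in> S"
    and L: "has_complex_derivative F L p" "\<And>v. L v = 0 \<Longrightarrow> v = 0"
  shows "biholomorphic_near F p"
proof -
  obtain F' where F': "\<And>x. x \<in> S \<Longrightarrow> has_complex_derivative F (blinfun_apply (F' x)) x"
    "continuous_on S F'"
    by (rule continuous_on_map_derivative [OF F(1,2)]) blast
  have Lp: "blinfun_apply (F' p) = L"
    using F'(1) [OF F(3)] L(1) unfolding has_complex_derivative_def
    by (meson has_derivative_unique)
  have lin: "linear L"
    using L(1) by (auto simp: has_complex_derivative_def has_derivative_bounded_linear bounded_linear.linear)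
  have "inj L"
    using L(2) linear_injective_0 [OF lin] by blast
  then obtain K where K: "linear K" "K \<circ> L = id"
    using linear_injective_left_inverse [OF lin] by blast
  have invf: "Blinfun K o\<^sub>L F' p = id_blinfun"
  proof (rule blinfun_eqI)
    fix v
    show "blinfun_apply (Blinfun K o\<^sub>L F' p) v = blinfun_apply id_blinfun v"
      using K by (simp add: Lp bounded_linear_Blinfun_apply linear_conv_bounded_linear fun_eq_iff)
  qed
  have der: "(F has_derivative blinfun_apply (F' x)) (at x)" if "x \<in> S" for x
    using F'(1) [OF that] by (simp add: has_complex_derivative_def)
  from inverse_function_theorem [OF F(2) der F'(2) F(3) invf]
  obtain A B G G' where AB: "open A" "A \<subseteq> S" "p \<in> A" "open B" "F p \<in> B" "homeomorphism A B F G"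
    and G: "\<And>y. y \<in> B \<Longrightarrow> (G has_derivative G' y) (at y)"
      "\<And>y. y \<in> B \<Longrightarrow> G' y = inv (blinfun_apply (F' (G y)))"
      "\<And>y. y \<in> B \<Longrightarrow> bij (blinfun_apply (F' (G y)))"
    by metis
  have "G holomorphic_map_on B"
    unfolding holomorphic_map_on_def
  proof (intro ballI exI conjI allI)
    fix y c v assume y: "y \<in> B"
    show "(G has_derivative G' y) (at y)" using G(1) [OF y] .
    have "G y \<in> S" using AB y unfolding homeomorphism_def by blast
    then have clin: "blinfun_apply (F' (G y)) (c *\<^sub>C G' y v) = c *\<^sub>C blinfun_apply (F' (G y)) (G' y v)"
      using F'(1) by (simp add: has_complex_derivative_def)
    have right: "blinfun_apply (F' (G y)) (G' y u) = u" for u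
      using G(2,3) [OF y] by (simp add: bij_is_surj surj_f_inv_f)
    have "blinfun_apply (F' (G y)) (G' y (c *\<^sub>C v)) = blinfun_apply (F' (G y)) (c *\<^sub>C G' y v)"
      using clin right by simp
    then show "G' y (c *\<^sub>C v) = c *\<^sub>C G' y v"
      using G(3) [OF y] by (meson bij_is_inj injD)
  qed
  moreover have "F holomorphic_map_on A" using F(1) AB(2) by (rule holomorphic_map_on_subset)
  ultimately show ?thesis unfolding biholomorphic_near_def using AB by blast
qed

section \<open>Segre preserving maps\<close>

text \<open>The germs at \<open>0\<close> that the theorem is about, with \<open>maps\<close> expressing in the parameters \<open>(z, \<zeta>)\<close> of
  the source hypersurface that it is mapped into the target.\<close>

locale segre_map =
  fixes Q Q' :: "('n::finite) Qdom \<Rightarrow> complex" and H Ht :: "'n pt \<Rightarrow> 'n pt"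
  assumes Q: "holomorphic_germ Q" and Q': "holomorphic_germ Q'"
    and H: "holomorphic_germ H" "H 0 = 0" and Ht: "holomorphic_germ Ht" "Ht 0 = 0"
    and Q_z_0: "\<forall>\<^sub>F (z, \<tau>) in nhds 0. Q (z, 0, \<tau>) = \<tau>"
    and Q'_z_0: "\<forall>\<^sub>F (z, \<tau>) in nhds 0. Q' (z, 0, \<tau>) = \<tau>"
    and Q'_0_\<xi>: "\<forall>\<^sub>F (\<xi>, \<tau>) in nhds 0. Q' (0, \<xi>, \<tau>) = \<tau>"
    and reality: "\<forall>\<^sub>F (z, \<xi>, w) in nhds 0. Q (z, \<xi>, conj_fun Q (\<xi>, z, w)) = w"
    and maps: "\<forall>\<^sub>F (z, \<zeta>) in nhds 0.
      snd (H (z, Q (z, \<zeta>))) = Q' (fst (H (z, Q (z, \<zeta>))), Ht \<zeta>)"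
    and nondegenerate: "holomorphically_nondegenerate Q"
begin

definition defect :: "'n pt \<times> 'n pt \<Rightarrow> complex" where
  "defect p = snd (H (fst p)) - Q' (fst (H (fst p)), Ht (snd p))"

lemma Q_0: "Q 0 = 0" and Q'_0: "Q' 0 = 0"
  using eventually_nhds_x_imp_x [OF Q_z_0] eventually_nhds_x_imp_x [OF Q'_z_0]
  by (simp_all add: zero_prod_def)

lemma conj_fun_Q_0: "conj_fun Q 0 = 0"
  by (simp add: conj_fun_eq Q_0)

lemma germ_H_fst: "holomorphic_germ (\<lambda>p :: 'n pt \<times> 'n pt. H (fst p))"
  and germ_Ht_snd: "holomorphic_germ (\<lambda>p :: 'n pt \<times> 'n pt. Ht (snd p))"
  by (rule holomorphic_germ_compose [OF _ _ H(1)] holomorphic_germ_compose [OF _ _ Ht(1)],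
      auto intro: holomorphic_germ_intros)+

lemma germ_defect: "holomorphic_germ defect"
proof -
  have "holomorphic_germ (\<lambda>p. Q' (fst (H (fst p)), Ht (snd p)))"
    by (rule holomorphic_germ_compose [OF _ _ Q'])
      (auto intro!: holomorphic_germ_intros germ_H_fst germ_Ht_snd simp: H Ht zero_prod_def [symmetric])
  then show ?thesis
    unfolding defect_def [abs_def] by (intro holomorphic_germ_diff holomorphic_germ_snd germ_H_fst)
qed

lemma defect_eq_0_on_hypersurface: "\<forall>\<^sub>F (z, \<zeta>) in nhds 0. defect ((z, Q (z, \<zeta>)), \<zeta>) = 0"
  using maps by (simp add: defect_def)

text \<open>At a fixed \<open>Z\<close> the defect differs from \<open>- Q' (f Z, Ht \<zeta>)\<close> by a constant, so it is annihilated by the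
  field that annihilates all \<open>Q' (z, Ht \<zeta>)\<close>.\<close>

lemma defect_eq_0_if_Ht_or_target_degenerate:
  assumes "\<not> holomorphically_nondegenerate Q' \<or> (\<forall>\<^sub>F \<zeta> in nhds 0. jacobian_det Ht \<zeta> = 0)"
  shows "\<forall>\<^sub>F p in nhds 0. defect p = 0"
proof -
  obtain a where a: "holomorphic_germ a" "\<not> (\<forall>\<^sub>F \<zeta> in nhds 0. a \<zeta> = 0)" and
    ann: "\<forall>\<^sub>F (z, \<zeta>) in nhds 0. \<exists>L. has_complex_derivative (\<lambda>\<zeta>. Q' (z, Ht \<zeta>)) L \<zeta> \<and> L (a \<zeta>) = 0"
    by (rule annihilating_field_pullback [OF Q' Ht assms]) blast
  have "\<forall>\<^sub>F p :: 'n pt \<times> 'n pt in nhds 0.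
      case (fst (H (fst p)), snd p) of (z, \<zeta>) \<Rightarrow>
        \<exists>L. has_complex_derivative (\<lambda>\<zeta>. Q' (z, Ht \<zeta>)) L \<zeta> \<and> L (a \<zeta>) = 0"
    by (rule eventually_holomorphic_germ [OF _ _ ann])
      (auto intro!: holomorphic_germ_intros germ_H_fst simp: H zero_prod_def [symmetric])
  then have "\<forall>\<^sub>F (Z, \<zeta>) in nhds 0. complex_dirderiv (0, a \<zeta>) defect (Z, \<zeta>) = 0"
  proof eventually_elim
    case (elim p)
    obtain Z \<zeta> where p: "p = (Z, \<zeta>)" by (cases p)
    obtain L where L: "has_complex_derivative (\<lambda>\<zeta>. Q' (fst (H Z), Ht \<zeta>)) L \<zeta>" "L (a \<zeta>) = 0"
      using elim by (auto simp: p)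
    have "complex_dirderiv (a \<zeta>) (\<lambda>\<zeta>. snd (H Z) - Q' (fst (H Z), Ht \<zeta>)) \<zeta> = 0 - L (a \<zeta>)"
      by (rule complex_dirderiv_eq)
        (rule has_complex_derivative_diff [OF has_complex_derivative_const L(1)])
    with L(2) show ?case by (simp add: p complex_dirderiv_snd_slice defect_def)
  qed
  then show ?thesis
    by (rule vanishes_off_hypersurface [OF Q Q_0
        no_annihilating_field_if_nondegenerate [OF Q nondegenerate] germ_defect defect_eq_0_on_hypersurface a])
qed

text \<open>The reality of the source: its complexification is also the graph of \<open>\<tau>\<close> over \<open>(\<xi>, Z)\<close> defined by
  \<open>conj_fun Q\<close>, which makes the roles of \<open>Z\<close> and \<open>\<zeta>\<close> interchangeable.\<close>

lemma defect_swap_eq_0_on_hypersurface: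
  "\<forall>\<^sub>F (\<xi>, Z) in nhds 0. defect (Z, (\<xi>, conj_fun Q (\<xi>, Z))) = 0"
proof -
  have germ: "holomorphic_germ (\<lambda>q :: 'n Qdom. (fst (snd q), fst q, conj_fun Q q))"
    by (intro holomorphic_germ_Pair holomorphic_germ_fst holomorphic_germ_snd holomorphic_germ_ident
        holomorphic_germ_conj_fun [OF Q])
  have "\<forall>\<^sub>F q in nhds 0. case (fst (snd q), fst q, conj_fun Q q) of (z, \<zeta>) \<Rightarrow> defect ((z, Q (z, \<zeta>)), \<zeta>) = 0"
    by (rule eventually_holomorphic_germ [OF germ _ defect_eq_0_on_hypersurface])
      (simp add: conj_fun_Q_0 zero_prod_def [symmetric])
  moreover have "\<forall>\<^sub>F q :: 'n Qdom in nhds 0. case (fst (snd q), fst q, snd (snd q)) of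
      (z, \<xi>, w) \<Rightarrow> Q (z, \<xi>, conj_fun Q (\<xi>, z, w)) = w"
    by (rule eventually_holomorphic_germ [OF _ _ reality])
      (auto intro!: holomorphic_germ_intros simp: zero_prod_def [symmetric])
  ultimately show ?thesis
    by eventually_elim (auto simp: case_prod_unfold)
qed

text \<open>The defect depends on \<open>Z\<close> through \<open>H Z\<close> only, so a field in the kernel of the derivative of \<open>H\<close>
  annihilates it; after exchanging \<open>Z\<close> and \<open>\<zeta>\<close> this is a field in the second group of variables.\<close>

lemma defect_eq_0_if_H_degenerate:
  assumes "\<forall>\<^sub>F Z in nhds 0. jacobian_det H Z = 0"
  shows "\<forall>\<^sub>F p in nhds 0. defect p = 0"
proof -
  obtain a where a: "holomorphic_germ a" "\<not> (\<forall>\<^sub>F Z in nhds 0. a Z = 0)" and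
    ker: "\<forall>\<^sub>F Z in nhds 0. \<exists>L. has_complex_derivative H L Z \<and> L (a Z) = 0"
    by (rule kernel_field_exists [OF H(1) assms]) blast
  let ?R = "\<lambda>p :: 'n pt \<times> 'n pt. defect (snd p, fst p)"
  have swap: "holomorphic_germ (\<lambda>p :: 'n pt \<times> 'n pt. (snd p, fst p))"
    by (intro holomorphic_germ_intros)
  have germ: "holomorphic_germ ?R"
    by (rule holomorphic_germ_compose [OF swap _ germ_defect]) (simp add: zero_prod_def [symmetric])
  have arg: "holomorphic_germ (\<lambda>p :: 'n pt \<times> 'n pt. (fst (H (snd p)), Ht (fst p)))"
    using holomorphic_germ_compose [OF swap _ holomorphic_germ_Pair
        [OF holomorphic_germ_fst [OF germ_H_fst] germ_Ht_snd]]
    by (simp add: zero_prod_def [symmetric])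
  have "\<forall>\<^sub>F p :: 'n pt \<times> 'n pt in nhds 0. \<exists>L. has_complex_derivative Q' L (fst (H (snd p)), Ht (fst p))"
    by (rule eventually_holomorphic_germ [OF arg _ eventually_has_complex_derivative [OF Q']])
      (simp add: H Ht zero_prod_def [symmetric])
  moreover have "\<forall>\<^sub>F p :: 'n pt \<times> 'n pt in nhds 0.
      \<exists>L. has_complex_derivative H L (snd p) \<and> L (a (snd p)) = 0"
    using ker by (rule eventually_nhds_0_snd)
  ultimately have ann: "\<forall>\<^sub>F (\<zeta>, Z) in nhds 0. complex_dirderiv (0, a Z) ?R (\<zeta>, Z) = 0"
  proof eventually_elim
    case (elim p)
    obtain \<zeta> Z where p: "p = (\<zeta>, Z)" by (cases p)
    let ?G = "\<lambda>y :: 'n pt. snd y - Q' (fst y, Ht \<zeta>)"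
    obtain L' where L': "has_complex_derivative Q' L' (fst (H Z), Ht \<zeta>)" using elim(1) by (auto simp: p)
    have "has_complex_derivative (\<lambda>y :: 'n pt. (fst y, Ht \<zeta>)) (\<lambda>v. (fst v, 0)) (H Z)"
      by (intro has_complex_derivative_Pair has_complex_derivative_const
          has_complex_derivative_bounded_linear bounded_linear_fst) simp
    from has_complex_derivative_compose [OF this L']
    have "has_complex_derivative (\<lambda>y. Q' (fst y, Ht \<zeta>)) (\<lambda>v. L' (fst v, 0)) (H Z)" .
    moreover have "has_complex_derivative snd snd (H Z)"
      by (rule has_complex_derivative_bounded_linear [OF bounded_linear_snd]) simp
    ultimately have G: "has_complex_derivative ?G (\<lambda>v. snd v - L' (fst v, 0)) (H Z)"
      by (rule has_complex_derivative_diff [rotated])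
    obtain L where L: "has_complex_derivative H L Z" "L (a Z) = 0" using elim(2) by (auto simp: p)
    have "complex_dirderiv (a Z) (\<lambda>Z. ?G (H Z)) Z = snd (L (a Z)) - L' (fst (L (a Z)), 0)"
      by (rule complex_dirderiv_eq) (rule has_complex_derivative_compose [OF L(1) G])
    also have "\<dots> = 0"
      using L(2) has_complex_derivative_at_0 [OF G] by simp
    finally show ?case by (simp add: p complex_dirderiv_snd_slice defect_def)
  qed
  have "\<forall>\<^sub>F (\<xi>, Z) in nhds 0. ?R ((\<xi>, conj_fun Q (\<xi>, Z)), Z) = 0"
    using defect_swap_eq_0_on_hypersurface by simp
  then have "\<forall>\<^sub>F p in nhds 0. ?R p = 0"
    by (rule vanishes_off_hypersurface [OF holomorphic_germ_conj_fun [OF Q] conj_fun_Q_0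
        no_annihilating_field_conj_fun [OF Q no_annihilating_field_if_nondegenerate
          [OF Q nondegenerate]] germ _ a ann])
  from eventually_holomorphic_germ [OF swap _ this] show ?thesis
    by (simp add: zero_prod_def [symmetric])
qed

text \<open>Setting \<open>\<zeta> = 0\<close> and \<open>Z = 0\<close> and using that the target is in normal coordinates gives \<open>g = 0\<close> and the
  vanishing of the last component of \<open>Ht\<close>; the remaining identity is then \<open>defect = 0\<close> again.\<close>

lemma transversally_null_if_defect_eq_0:
  assumes R0: "\<forall>\<^sub>F p in nhds 0. defect p = 0"
  shows "transversally_null H Ht"
    and "\<forall>\<^sub>F (Z, \<zeta>) in nhds 0. Q' (fst (H Z), fst (Ht \<zeta>), 0) = 0"
    and "\<forall>\<^sub>F p in nhds 0. snd (H (fst p)) = Q' (fst (H (fst p)), Ht (snd p))"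
proof -
  have "\<forall>\<^sub>F Z in nhds 0. defect (Z, 0) = 0"
    by (rule eventually_holomorphic_germ [OF _ _ R0])
      (auto intro!: holomorphic_germ_intros simp: zero_prod_def [symmetric])
  moreover have "\<forall>\<^sub>F Z in nhds 0. case (fst (H Z), 0) of (z, \<tau>) \<Rightarrow> Q' (z, 0, \<tau>) = \<tau>"
    by (rule eventually_holomorphic_germ [OF _ _ Q'_z_0])
      (auto intro!: holomorphic_germ_intros H simp: H zero_prod_def [symmetric])
  ultimately have g: "\<forall>\<^sub>F Z in nhds 0. snd (H Z) = 0"
    by eventually_elim (simp add: defect_def Ht zero_prod_def [symmetric])
  have "\<forall>\<^sub>F \<zeta> in nhds 0. defect (0, \<zeta>) = 0"
    by (rule eventually_holomorphic_germ [OF _ _ R0])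
      (auto intro!: holomorphic_germ_intros simp: zero_prod_def [symmetric])
  moreover have "\<forall>\<^sub>F \<zeta> in nhds 0. case Ht \<zeta> of (\<xi>, \<tau>) \<Rightarrow> Q' (0, \<xi>, \<tau>) = \<tau>"
    by (rule eventually_holomorphic_germ [OF Ht Q'_0_\<xi>])
  ultimately have gt: "\<forall>\<^sub>F \<zeta> in nhds 0. snd (Ht \<zeta>) = 0"
    by eventually_elim (auto simp: defect_def H split: prod.splits)
  show "transversally_null H Ht" unfolding transversally_null_def using g gt by blast
  show "\<forall>\<^sub>F p in nhds 0. snd (H (fst p)) = Q' (fst (H (fst p)), Ht (snd p))"
    using R0 by (simp add: defect_def)
  show "\<forall>\<^sub>F (Z, \<zeta>) in nhds 0. Q' (fst (H Z), fst (Ht \<zeta>), 0) = 0"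
    using R0 eventually_nhds_0_fst [OF g] eventually_nhds_0_snd [OF gt]
  proof eventually_elim
    case (elim p)
    then have "Ht (snd p) = (fst (Ht (snd p)), 0)" by (simp add: prod_eq_iff)
    with elim show ?case by (simp add: case_prod_unfold defect_def)
  qed
qed

text \<open>The product of two nonzero germs is nonzero. That the determinant of \<open>H\<close> does not vanish identically along the
  hypersurface follows from \<open>Q (z, 0, \<tau>) = \<tau>\<close>: the points \<open>(z, Q (z, 0, \<tau>))\<close> fill a neighbourhood
  of \<open>0\<close>.\<close>

lemma point_of_maximal_rank:
  assumes detH: "\<not> (\<forall>\<^sub>F Z in nhds 0. jacobian_det H Z = 0)"
    and detHt: "\<not> (\<forall>\<^sub>F \<zeta> in nhds 0. jacobian_det Ht \<zeta> = 0)"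
    and P: "\<forall>\<^sub>F p in nhds 0. P p"
  obtains z \<zeta> where "P (z, \<zeta>)" "jacobian_det H (z, Q (z, \<zeta>)) \<noteq> 0" "jacobian_det Ht \<zeta> \<noteq> 0"
proof -
  obtain V where V: "open V" "0 \<in> V" "Q holomorphic_map_on V"
    using Q unfolding holomorphic_germ_def by blast
  obtain s where s: "0 < s" "H holomorphic_map_on ball 0 s"
    using holomorphic_germ_ball [OF H(1)] .
  obtain t where t: "0 < t" "Ht holomorphic_map_on ball 0 t"
    using holomorphic_germ_ball [OF Ht(1)] .
  have det: "jacobian_det F holomorphic_map_on ball 0 e"
    if "F holomorphic_map_on ball 0 e" for F :: "'n pt \<Rightarrow> 'n pt" and e
    unfolding jacobian_det_def
    by (intro holomorphic_map_on_jacobian_minor holomorphic_map_on_coord that open_ball)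
  have germ: "holomorphic_germ (\<lambda>p :: 'n Qdom. (fst p, Q p))"
    by (intro holomorphic_germ_Pair holomorphic_germ_fst holomorphic_germ_ident Q)
  have "\<forall>\<^sub>F p in nhds 0. (fst p, Q p) \<in> ball 0 s"
    by (rule eventually_holomorphic_germ [OF germ _ eventually_nhds_in_open [OF open_ball]])
      (use s(1) in \<open>simp_all add: Q_0 zero_prod_def [symmetric]\<close>)
  moreover have "\<forall>\<^sub>F p :: 'n Qdom in nhds 0. snd p \<in> ball 0 t"
    by (rule eventually_holomorphic_germ [OF holomorphic_germ_snd [OF holomorphic_germ_ident] _
          eventually_nhds_in_open [OF open_ball]])
      (use t(1) in simp_all)
  ultimately have "\<forall>\<^sub>F p in nhds 0. p \<in> V \<and> (fst p, Q p) \<in> ball 0 s \<and> snd p \<in> ball 0 t \<and> P p"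
    using P eventually_nhds_in_open [OF V(1,2)] by eventually_elim simp
  then obtain r where r: "0 < r" and rU: "\<And>z \<zeta>. z \<in> ball 0 r \<Longrightarrow> \<zeta> \<in> ball 0 r \<Longrightarrow>
      (z, \<zeta>) \<in> V \<and> (z, Q (z, \<zeta>)) \<in> ball 0 s \<and> \<zeta> \<in> ball 0 t \<and> P (z, \<zeta>)"
    unfolding eventually_nhds_0_prod_iff by auto
  let ?U = "ball (0::complex^'n) r \<times> ball (0::'n pt) r"
  have U: "open ?U" "convex ?U" using ball_product [OF r] by blast+
  have QU: "Q holomorphic_map_on ?U" using V(3) by (rule holomorphic_map_on_subset) (use rU in auto)
  have "\<not> (\<forall>p\<in>?U. jacobian_det H (fst p, Q p) * jacobian_det Ht (snd p) = 0)"
  proof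
    assume *: "\<forall>p\<in>?U. jacobian_det H (fst p, Q p) * jacobian_det Ht (snd p) = 0"
    have "(\<forall>p\<in>?U. jacobian_det H (fst p, Q p) = 0) \<or> (\<forall>p\<in>?U. jacobian_det Ht (snd p) = 0)"
    proof (rule holomorphic_mult_eq_0 [OF U])
      show "(\<lambda>p. jacobian_det H (fst p, Q p)) holomorphic_map_on ?U"
        by (rule holomorphic_map_on_compose [OF _ det [OF s(2)]])
          (use rU in \<open>auto intro!: holomorphic_map_on_Pair holomorphic_map_on_fst holomorphic_map_on_ident QU\<close>)
      show "(\<lambda>p. jacobian_det Ht (snd p)) holomorphic_map_on ?U"
        by (rule holomorphic_map_on_compose [OF _ det [OF t(2)]])
          (use rU r in \<open>auto intro!: holomorphic_map_on_snd holomorphic_map_on_ident\<close>)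
    next
      show "jacobian_det H (fst p, Q p) * jacobian_det Ht (snd p) = 0" if "p \<in> ?U" for p
        using * that by (rule bspec)
    qed
    then show False
    proof
      assume Ht0: "\<forall>p\<in>?U. jacobian_det Ht (snd p) = 0"
      have "jacobian_det Ht \<zeta> = 0" if "\<zeta> \<in> ball 0 r" for \<zeta>
        using Ht0 [rule_format, of "(0, \<zeta>)"] that r by simp
      then have "\<forall>\<^sub>F \<zeta> in nhds 0. jacobian_det Ht \<zeta> = 0"
        unfolding eventually_nhds using r by (intro exI [of _ "ball 0 r"]) auto
      with detHt show False by blast
    next
      assume "\<forall>p\<in>?U. jacobian_det H (fst p, Q p) = 0"
      then have "\<forall>\<^sub>F p in nhds 0. jacobian_det H (fst p, Q p) = 0"
        unfolding eventually_nhds_0_prod_iff using r by auto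
      moreover have "holomorphic_germ (\<lambda>Z :: 'n pt. (fst Z, 0 :: complex^'n, snd Z))"
        by (intro holomorphic_germ_intros)
      ultimately have "\<forall>\<^sub>F Z in nhds 0. jacobian_det H (fst Z, Q (fst Z, 0, snd Z)) = 0"
        using eventually_holomorphic_germ
          [of "\<lambda>Z. (fst Z, 0, snd Z)" "\<lambda>p. jacobian_det H (fst p, Q p) = 0"]
        by (simp add: zero_prod_def [symmetric])
      with Q_z_0 have "\<forall>\<^sub>F Z in nhds 0. jacobian_det H Z = 0"
        by eventually_elim auto
      with detH show False by blast
    qed
  qed
  then show thesis using that rU by fastforce
qed

lemma biholomorphic_near_map_prod:
  assumes hol: "map_prod H Ht holomorphic_map_on D" "open D" "(Z, \<zeta>) \<in> D"
    and det: "jacobian_det H Z \<noteq> 0" "jacobian_det Ht \<zeta> \<noteq> 0"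
  shows "biholomorphic_near (map_prod H Ht) (Z, \<zeta>)"
proof -
  have HS: "H holomorphic_map_on {Z. (Z, \<zeta>) \<in> D}"
  proof -
    have "(\<lambda>Z. fst (map_prod H Ht (Z, \<zeta>))) holomorphic_map_on {Z. (Z, \<zeta>) \<in> D}"
      by (rule holomorphic_map_on_fst, rule holomorphic_map_on_compose [OF _ hol(1)])
        (auto intro: holomorphic_map_on_Pair holomorphic_map_on_const holomorphic_map_on_ident)
    then show ?thesis by simp
  qed
  have HtS: "Ht holomorphic_map_on {\<zeta>. (Z, \<zeta>) \<in> D}"
  proof -
    have "(\<lambda>\<zeta>. snd (map_prod H Ht (Z, \<zeta>))) holomorphic_map_on {\<zeta>. (Z, \<zeta>) \<in> D}"
      by (rule holomorphic_map_on_snd, rule holomorphic_map_on_compose [OF _ hol(1)])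
        (auto intro: holomorphic_map_on_Pair holomorphic_map_on_const holomorphic_map_on_ident)
    then show ?thesis by simp
  qed
  obtain L where L: "has_complex_derivative H L Z"
    using HS hol(3) unfolding holomorphic_map_on_iff by blast
  obtain L' where L': "has_complex_derivative Ht L' \<zeta>"
    using HtS hol(3) unfolding holomorphic_map_on_iff by blast
  have fst: "has_complex_derivative fst fst (Z, \<zeta>)" and snd: "has_complex_derivative snd snd (Z, \<zeta>)"
    by (intro has_complex_derivative_bounded_linear bounded_linear_fst bounded_linear_snd; simp)+
  have "has_complex_derivative (\<lambda>p. (H (fst p), Ht (snd p))) (\<lambda>v. (L (fst v), L' (snd v))) (Z, \<zeta>)"
    by (intro has_complex_derivative_Pair has_complex_derivative_compose [OF fst]
        has_complex_derivative_compose [OF snd]) (use L L' in simp_all)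
  then have "has_complex_derivative (map_prod H Ht) (\<lambda>v. (L (fst v), L' (snd v))) (Z, \<zeta>)"
    by (simp add: map_prod_def case_prod_unfold)
  then show ?thesis
  proof (rule biholomorphic_near_if_injective_derivative [OF hol])
    fix v assume "(L (fst v), L' (snd v)) = 0"
    then have v: "L (fst v) = 0" "L' (snd v) = 0" by (simp_all add: zero_prod_def)
    have "fst v = 0"
      by (rule injective_if_jacobian_det_nonzero [OF HS _ L det(1) v(1)]) (simp add: hol(3))
    moreover have "snd v = 0"
      by (rule injective_if_jacobian_det_nonzero [OF HtS _ L' det(2) v(2)]) (simp add: hol(3))
    ultimately show "v = 0" by (simp add: prod_eq_iff)
  qed
qed

end

lemma holomorphic_germ_map_prod:
  fixes H Ht :: "('n::finite) pt \<Rightarrow> 'n pt"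
  assumes "open D" "0 \<in> D" "map_prod H Ht holomorphic_map_on D" "map_prod H Ht 0 = 0"
  shows "holomorphic_germ H" "holomorphic_germ Ht" "H 0 = 0" "Ht 0 = 0"
proof -
  have germ: "holomorphic_germ (map_prod H Ht)" using assms holomorphic_germI by blast
  have "holomorphic_germ (\<lambda>Z. fst (map_prod H Ht (Z, 0)))" "holomorphic_germ (\<lambda>Z. snd (map_prod H Ht (0, Z)))"
    by (intro holomorphic_germ_fst holomorphic_germ_snd holomorphic_germ_compose [OF _ _ germ];
        auto intro!: holomorphic_germ_intros simp: zero_prod_def [symmetric])+
  then show "holomorphic_germ H" "holomorphic_germ Ht" by simp_all
  show "H 0 = 0" "Ht 0 = 0" using assms(4) by (simp_all add: zero_prod_def map_prod_def)
qed

theorem theorem1p2: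
  fixes M M' :: "('n::finite) pt set"
    and Q Q' :: "'n Qdom \<Rightarrow> complex"
    and V V' :: "'n Qdom set"
    and H Ht :: "'n pt \<Rightarrow> 'n pt"
    and D :: "('n pt \<times> 'n pt) set"
  assumes "real_analytic_hypersurface M" and "0 \<in> M" and "normal_coordinates M V Q"
    and "real_analytic_hypersurface M'" and "0 \<in> M'" and "normal_coordinates M' V' Q'"
    and "holomorphically_nondegenerate Q"
    and "HSPM D H Ht (complexification V Q) (complexification V' Q')"
  shows "(transversally_null H Ht \<and>
          (\<forall>\<^sub>F (Z, \<zeta>) in nhds 0. Q' (fst (H Z), fst (Ht \<zeta>), 0) = 0) \<and>
          (\<forall>\<^sub>F p in nhds 0. map_prod H Ht p \<in> complexification V' Q')) \<or>
         ((\<exists>p \<in> D \<inter> complexification V Q. biholomorphic_near (map_prod H Ht) p) \<and>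
          holomorphically_nondegenerate Q')"
proof -
  have V: "open V" "0 \<in> V" "Q holomorphic_map_on V"
    and Qz: "\<forall>\<^sub>F (z, \<tau>) in nhds 0. Q (z, 0, \<tau>) = \<tau>"
    and real: "\<forall>\<^sub>F (z, \<xi>, w) in nhds 0. Q (z, \<xi>, conj_fun Q (\<xi>, z, w)) = w"
    using assms(3) unfolding normal_coordinates_def by blast+
  have V': "open V'" "0 \<in> V'" "Q' holomorphic_map_on V'"
    and Q'z: "\<forall>\<^sub>F (z, \<tau>) in nhds 0. Q' (z, 0, \<tau>) = \<tau>"
    and Q'0: "\<forall>\<^sub>F (\<xi>, \<tau>) in nhds 0. Q' (0, \<xi>, \<tau>) = \<tau>"
    using assms(6) unfolding normal_coordinates_def by blast+
  have D: "open D" "0 \<in> D" "map_prod H Ht holomorphic_map_on D" "map_prod H Ht 0 = 0"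
    and into: "\<forall>\<^sub>F p in nhds 0. p \<in> complexification V Q \<longrightarrow> map_prod H Ht p \<in> complexification V' Q'"
    using assms(8) unfolding HSPM_def by blast+
  note germs = holomorphic_germ_map_prod [OF D]
  have Q: "holomorphic_germ Q" and Q': "holomorphic_germ Q'"
    using V V' holomorphic_germI by blast+
  have Q_0: "Q 0 = 0"
    using eventually_nhds_x_imp_x [OF Qz] by (simp add: zero_prod_def)
  let ?\<Psi> = "\<lambda>p :: 'n Qdom. ((fst p, Q p), snd p)"
  have \<Psi>: "holomorphic_germ ?\<Psi>" "?\<Psi> 0 = 0"
    by (auto intro!: holomorphic_germ_Pair holomorphic_germ_fst holomorphic_germ_snd
        holomorphic_germ_ident Q simp: Q_0 zero_prod_def [symmetric])
  have mem: "?\<Psi> p \<in> complexification V Q" if "p \<in> V" for p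
    using that by (cases p) (auto simp: complexification_def)
  have maps: "\<forall>\<^sub>F (z, \<zeta>) in nhds 0. snd (H (z, Q (z, \<zeta>))) = Q' (fst (H (z, Q (z, \<zeta>))), Ht \<zeta>)"
    using eventually_holomorphic_germ [OF \<Psi> into] eventually_nhds_in_open [OF V(1,2)]
  proof eventually_elim
    case (elim p)
    then have "map_prod H Ht (?\<Psi> p) \<in> complexification V' Q'" using mem by blast
    then show ?case by (auto simp: complexification_def case_prod_unfold prod_eq_iff)
  qed
  interpret segre_map Q Q' H Ht
    by unfold_locales (use Q Q' germs Qz Q'z Q'0 real maps assms(7) in auto)
  show ?thesis
  proof (cases "\<forall>\<^sub>F p in nhds 0. defect p = 0")
    case True
    note null = transversally_null_if_defect_eq_0 [OF True]
    have "\<forall>\<^sub>F p in nhds 0. (fst (H (fst p)), Ht (snd p)) \<in> V'"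
      by (rule eventually_holomorphic_germ [OF _ _ eventually_nhds_in_open [OF V'(1,2)]])
        (auto intro!: holomorphic_germ_Pair holomorphic_germ_fst germ_H_fst germ_Ht_snd
          simp: germs zero_prod_def [symmetric])
    with null(3) have "\<forall>\<^sub>F p in nhds 0. map_prod H Ht p \<in> complexification V' Q'"
      by eventually_elim (auto simp: complexification_def map_prod_def case_prod_unfold)
    with null(1,2) show ?thesis by blast
  next
    case False
    then have nondeg: "holomorphically_nondegenerate Q'"
      and det: "\<not> (\<forall>\<^sub>F Z in nhds 0. jacobian_det H Z = 0)" "\<not> (\<forall>\<^sub>F \<zeta> in nhds 0. jacobian_det Ht \<zeta> = 0)"
      using defect_eq_0_if_Ht_or_target_degenerate defect_eq_0_if_H_degenerate by blast+
    have "\<forall>\<^sub>F p in nhds 0. p \<in> V \<and> ?\<Psi> p \<in> D"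
      using eventually_holomorphic_germ [OF \<Psi> eventually_nhds_in_open [OF D(1,2)]]
        eventually_nhds_in_open [OF V(1,2)] by eventually_elim simp
    from point_of_maximal_rank [OF det this]
    obtain z \<zeta> where p: "(z, \<zeta>) \<in> V" "?\<Psi> (z, \<zeta>) \<in> D"
      "jacobian_det H (z, Q (z, \<zeta>)) \<noteq> 0" "jacobian_det Ht \<zeta> \<noteq> 0" by blast
    then have "biholomorphic_near (map_prod H Ht) (?\<Psi> (z, \<zeta>))"
      using biholomorphic_near_map_prod [OF D(3,1)] by simp
    then show ?thesis using nondeg p(2) mem [OF p(1)] by blast
  qed
qed

end
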